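(* Let $X\neq\{0\}$ be a Banach space, let $t_0<t_1$ be real numbers, and let $\alpha,\beta\in[0,\infty)$ satisfy $\alpha<\beta$. Then $$C^{\beta}([t_0,t_1];X)\subsetneq C^{\alpha}([t_0,t_1];X),$$ and the inclusion is continuous, that is, there exists $M>0$ such that $\|f\|_{C^{\alpha}([t_0,t_1];X)}\le M\|f\|_{C^{\beta}([t_0,t_1];X)}$ for every $f\in C^{\beta}([t_0,t_1];X)$.
   Context: $\mathbb{N}=\{0,1,2,\ldots\}$. $[\alpha]$ denotes the smallest integer greater than or equal to $\alpha$. For $\alpha>0$ the Riemann–Liouville (RL) fractional integral is $J_{t_0,t}^{\alpha}f(t)=\frac{1}{\Gamma(\alpha)}\int_{t_0}^{t}(t-s)^{\alpha-1}f(s)\,ds$ (Bochner integral), and $J_{t_0,t}^{0}f=f$. The RL fractional derivative is $D_{t_0,t}^{\alpha}f(t)=\frac{d^{[\alpha]}}{dt^{[\alpha]}}\big[J_{t_0,t}^{[\alpha]-\alpha}f(t)\big]$, with the derivative taken in the weak sense on $(t_0,t_1)$. The Caputo fractional derivative is $cD_{t_0,t}^{\alpha}f(t)=D_{t_0,t}^{\alpha}\Big[f(t)-\sum_{j=0}^{[\alpha]-1}\frac{f^{(j)}(t_0)}{j!}(t-t_0)^j\Big]$. Writing that such a derivative belongs to $C^0([t_0,t_1];X)$ means that the weak derivative exists and has a continuous representative on $[t_0,t_1]$. For an integer $k\ge0$, $C^{k}([t_0,t_1];X)$ is the space of $k$-times continuously differentiable functions with norm $\sum_{j=0}^k\sup_t\|f^{(j)}(t)\|_X$.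 For $\alpha>0$, $$C^{\alpha}([t_0,t_1];X)=\{f\in C^{[\alpha]-1}([t_0,t_1];X): cD_{t_0,t}^{\alpha}f\in C^0([t_0,t_1];X)\},$$ with norm $\|f\|_{C^{\alpha}}=\|f\|_{C^{[\alpha]-1}([t_0,t_1];X)}+\|cD_{t_0,t}^{\alpha}f\|_{C^0([t_0,t_1];X)}$ (for $\alpha$ a positive integer this is the classical space of $\alpha$-times continuously differentiable functions); for $\alpha=0$ it is $C^0([t_0,t_1];X)$ with the supremum norm. *)

theory Defs
  imports "HOL-Analysis.Analysis"
begin

(* The library's has_bochner_integral demands a second countable (hence separable) target.
   The same definition, built on the library's simple functions, is stated here for arbitrary
   normed targets.  The L1-approximation by simple functions forces almost separable values, so
   this is the usual integral of strongly measurable functions, with no separability assumption. *)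

inductive has_bochner_int :: "'a measure \<Rightarrow> ('a \<Rightarrow> 'b::real_normed_vector) \<Rightarrow> 'b \<Rightarrow> bool"
  for M f x where
  "f \<in> borel_measurable M \<Longrightarrow>
    (\<And>i. Bochner_Integration.simple_bochner_integrable M (s i)) \<Longrightarrow>
    (\<lambda>i. \<integral>\<^sup>+ y. ennreal (norm (f y - s i y)) \<partial>M) \<longlonglongrightarrow> 0 \<Longrightarrow>
    (\<lambda>i. Bochner_Integration.simple_bochner_integral M (s i)) \<longlonglongrightarrow> x \<Longrightarrow>
    has_bochner_int M f x"

definition bochner_integrable :: "'a measure \<Rightarrow> ('a \<Rightarrow> 'b::real_normed_vector) \<Rightarrow> bool" where
  "bochner_integrable M f \<longleftrightarrow> (\<exists>x. has_bochner_int M f x)"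

definition bochner_int :: "'a measure \<Rightarrow> ('a \<Rightarrow> 'b::real_normed_vector) \<Rightarrow> 'b" where
  "bochner_int M f = (if bochner_integrable M f then THE x. has_bochner_int M f x else 0)"

lemma has_bochner_int_eq_has_bochner_integral:
  fixes f :: "'a \<Rightarrow> 'b::{real_normed_vector, second_countable_topology}"
  shows "has_bochner_int M f x \<longleftrightarrow> has_bochner_integral M f x"
  by (simp add: has_bochner_int.simps has_bochner_integral.simps)

lemma bochner_int_eq_lebesgue_integral:
  fixes f :: "'a \<Rightarrow> 'b::{real_normed_vector, second_countable_topology}"
  shows "bochner_int M f = integral\<^sup>L M f"
  by (simp add: bochner_int_def bochner_integrable_def lebesgue_integral_def
      has_bochner_int_eq_has_bochner_integral[abs_def])

(* Functions on [a,b] are represented by total functions.  None of the spaces and norms below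
   looks at values outside [a,b]; in particular derivatives at the end points are one-sided. *)

primrec nderiv :: "real set \<Rightarrow> nat \<Rightarrow> (real \<Rightarrow> 'a::real_normed_vector) \<Rightarrow> real \<Rightarrow> 'a" where
  "nderiv S 0 f = f"
| "nderiv S (Suc n) f = (\<lambda>t. vector_derivative (nderiv S n f) (at t within S))"

definition Ck_space :: "nat \<Rightarrow> real \<Rightarrow> real \<Rightarrow> (real \<Rightarrow> 'a::real_normed_vector) set" where
  "Ck_space k a b =
    {f. (\<forall>j<k. \<forall>t\<in>{a..b}. nderiv {a..b} j f differentiable (at t within {a..b})) \<and>
        continuous_on {a..b} (nderiv {a..b} k f)}"

definition sup_norm :: "real \<Rightarrow> real \<Rightarrow> (real \<Rightarrow> 'a::real_normed_vector) \<Rightarrow> real" where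
  "sup_norm a b f = (SUP t\<in>{a..b}. norm (f t))"

definition Ck_norm :: "nat \<Rightarrow> real \<Rightarrow> real \<Rightarrow> (real \<Rightarrow> 'a::real_normed_vector) \<Rightarrow> real" where
  "Ck_norm k a b f = (\<Sum>j=0..k. sup_norm a b (nderiv {a..b} j f))"

definition test_function :: "real \<Rightarrow> real \<Rightarrow> (real \<Rightarrow> real) \<Rightarrow> bool" where
  "test_function a b \<phi> \<longleftrightarrow>
    (\<forall>n x. (deriv ^^ n) \<phi> differentiable (at x)) \<and>
    (\<exists>c d. a < c \<and> d < b \<and> (\<forall>x. x \<notin> {c..d} \<longrightarrow> \<phi> x = 0))"

definition locally_bochner_integrable ::
    "real \<Rightarrow> real \<Rightarrow> (real \<Rightarrow> 'a::real_normed_vector) \<Rightarrow> bool" where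
  "locally_bochner_integrable a b g \<longleftrightarrow>
    (\<forall>c d. a < c \<longrightarrow> d < b \<longrightarrow> bochner_integrable (lebesgue_on {c..d}) g)"

(* h is an n-th weak derivative of g on the open interval (a,b) *)
definition has_weak_deriv ::
    "nat \<Rightarrow> real \<Rightarrow> real \<Rightarrow> (real \<Rightarrow> 'a::real_normed_vector) \<Rightarrow> (real \<Rightarrow> 'a) \<Rightarrow> bool" where
  "has_weak_deriv n a b g h \<longleftrightarrow>
    locally_bochner_integrable a b g \<and> locally_bochner_integrable a b h \<and>
    (\<forall>\<phi>. test_function a b \<phi> \<longrightarrow>
      bochner_int (lebesgue_on {a<..<b}) (\<lambda>t. (deriv ^^ n) \<phi> t *\<^sub>R g t) =
      (-1) ^ n *\<^sub>R bochner_int (lebesgue_on {a<..<b}) (\<lambda>t. \<phi> t *\<^sub>R h t))"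

definition RL_integral ::
    "real \<Rightarrow> real \<Rightarrow> (real \<Rightarrow> 'a::real_normed_vector) \<Rightarrow> real \<Rightarrow> 'a" where
  "RL_integral \<alpha> a f =
    (if \<alpha> = 0 then f
     else (\<lambda>t. (1 / Gamma \<alpha>) *\<^sub>R
       bochner_int (lebesgue_on {a..t}) (\<lambda>s. ((t - s) powr (\<alpha> - 1)) *\<^sub>R f s)))"

definition has_RL_deriv ::
    "real \<Rightarrow> real \<Rightarrow> real \<Rightarrow> (real \<Rightarrow> 'a::real_normed_vector) \<Rightarrow> (real \<Rightarrow> 'a) \<Rightarrow> bool" where
  "has_RL_deriv \<alpha> a b f h \<longleftrightarrow>
    has_weak_deriv (nat \<lceil>\<alpha>\<rceil>) a b (RL_integral (of_int \<lceil>\<alpha>\<rceil> - \<alpha>) a f) h"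

definition has_Caputo_deriv ::
    "real \<Rightarrow> real \<Rightarrow> real \<Rightarrow> (real \<Rightarrow> 'a::real_normed_vector) \<Rightarrow> (real \<Rightarrow> 'a) \<Rightarrow> bool" where
  "has_Caputo_deriv \<alpha> a b f h \<longleftrightarrow>
    has_RL_deriv \<alpha> a b
      (\<lambda>t. f t - (\<Sum>j<nat \<lceil>\<alpha>\<rceil>. ((t - a) ^ j / fact j) *\<^sub>R nderiv {a..b} j f a)) h"

definition Caputo_continuous ::
    "real \<Rightarrow> real \<Rightarrow> real \<Rightarrow> (real \<Rightarrow> 'a::real_normed_vector) \<Rightarrow> bool" where
  "Caputo_continuous \<alpha> a b f \<longleftrightarrow>
    (\<exists>h. continuous_on {a..b} h \<and> has_Caputo_deriv \<alpha> a b f h)"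

(* The continuous representative; it is determined on [a,b], the only place it is used. *)
definition Caputo_deriv ::
    "real \<Rightarrow> real \<Rightarrow> real \<Rightarrow> (real \<Rightarrow> 'a::real_normed_vector) \<Rightarrow> real \<Rightarrow> 'a" where
  "Caputo_deriv \<alpha> a b f = (SOME h. continuous_on {a..b} h \<and> has_Caputo_deriv \<alpha> a b f h)"

definition Calpha_space ::
    "real \<Rightarrow> real \<Rightarrow> real \<Rightarrow> (real \<Rightarrow> 'a::real_normed_vector) set" where
  "Calpha_space \<alpha> a b =
    (if \<alpha> = 0 then Ck_space 0 a b
     else {f \<in> Ck_space (nat \<lceil>\<alpha>\<rceil> - 1) a b. Caputo_continuous \<alpha> a b f})"

definition Calpha_norm ::
    "real \<Rightarrow> real \<Rightarrow> real \<Rightarrow> (real \<Rightarrow> 'a::real_normed_vector) \<Rightarrow> real" where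
  "Calpha_norm \<alpha> a b f =
    (if \<alpha> = 0 then sup_norm a b f
     else Ck_norm (nat \<lceil>\<alpha>\<rceil> - 1) a b f + sup_norm a b (Caputo_deriv \<alpha> a b f))"

end

theory Submission
  imports Defs "HOL-Real_Asymp.Real_Asymp"
begin

text \<open>
  Let \<open>J\<^sup>\<alpha>\<close> be the Riemann--Liouville integral, \<open>n = \<lceil>\<beta>\<rceil>\<close> and
  \<open>e\<^sub>\<gamma>(t) = (t - t\<^sub>0)\<^sup>\<gamma> / \<Gamma>(\<gamma> + 1)\<close>. The key fact is that \<open>f \<in> C\<^sup>\<beta>\<close> with Caputo derivative
  \<open>h\<close> if and only if \<open>f = \<Sum>j<n. c\<^sub>j e\<^sub>j + J\<^sup>\<beta> h\<close> with \<open>h\<close> continuous: du Bois-Reymond's lemma shows that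
  \<open>J\<close> of order \<open>n - \<beta>\<close> of the Taylor remainder differs from \<open>J\<^sup>n h\<close> by a polynomial of degree
  less than \<open>n\<close>, that polynomial has vanishing derivatives at \<open>t\<^sub>0\<close>, and \<open>J\<close> is injective on continuous
  functions. Since \<open>J\<^sup>\<alpha> e\<^sub>\<gamma>\<close> is \<open>e\<close> of order \<open>\<alpha> + \<gamma>\<close> and \<open>J\<close> is a semigroup, such an \<open>f\<close> has a Caputo derivative of order
  \<open>\<alpha>\<close>, namely the sum of the \<open>c\<^sub>j\<close> times \<open>e\<close> of order \<open>j - \<alpha>\<close>, for \<open>\<lceil>\<alpha>\<rceil> \<le> j < n\<close>, plus \<open>J\<close> of order
  \<open>\<beta> - \<alpha>\<close> of \<open>h\<close>; this gives the inclusion and the norm bound. It also shows that this derivative is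
  Hoelder continuous at \<open>t\<^sub>0\<close>, so \<open>J\<^sup>\<alpha> k\<close> is not in \<open>C\<^sup>\<beta>\<close> when \<open>k\<close> has a logarithmic modulus of
  continuity at \<open>t\<^sub>0\<close>.

  Bochner integrals are reduced to Henstock--Kurzweil integrals, and identities for \<open>J\<close> are checked
  on monomials, which are dense (with vector coefficients) by Bernstein approximation.
\<close>

section \<open>Bochner integrals of scalar times continuous functions\<close>

text \<open>\<open>s\<close> is the finite sum of its values times the indicators of its level sets
  \<open>A y\<close>, and each level set is measurable of finite measure, so every summand has a
  gauge integral.\<close>

lemma simple_bochner_integrable_has_integral:
  fixes s :: "real \<Rightarrow> 'a::banach"
  assumes S: "S \<in> lmeasurable"
    and s: "Bochner_Integration.simple_bochner_integrable (lebesgue_on S) s"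
  shows "(s has_integral Bochner_Integration.simple_bochner_integral (lebesgue_on S) s) S"
proof -
  have S': "S \<in> sets lebesgue" and [simp]: "space (lebesgue_on S) = S"
    using S by auto
  have sf: "simple_function (lebesgue_on S) s"
    using s by (rule Bochner_Integration.simple_bochner_integrable.cases)
  define A where "A y = {x \<in> S. s x = y}" for y
  have fin: "finite (s ` S)"
    using simple_functionD(1)[OF sf] by simp
  have A: "A y \<in> lmeasurable" for y
  proof -
    have "A y \<in> sets (lebesgue_on S)"
      using simple_functionD(2)[OF sf, of "{y}"] by (simp add: A_def vimage_def Int_def conj_commute)
    then have "A y \<in> sets lebesgue"
      using S' by (simp add: sets_restrict_space_iff)
    moreover have "A y \<subseteq> S" by (auto simp: A_def)
    ultimately show ?thesis
      using S fmeasurableI2 by blast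
  qed
  have "((\<lambda>x. \<Sum>y\<in>s ` S. indicat_real (A y) x *\<^sub>R y) has_integral
      (\<Sum>y\<in>s ` S. measure (lebesgue_on S) (A y) *\<^sub>R y)) S"
  proof (intro has_integral_sum fin has_integral_scaleR_left)
    fix y
    have "(indicat_real (A y) has_integral measure lebesgue (A y)) UNIV"
      using A lmeasurable_iff_indicator_has_integral by blast
    moreover have "indicat_real (A y) = (\<lambda>x. if x \<in> S then indicat_real (A y) x else 0)"
      by (auto simp: A_def indicator_def)
    ultimately have "(indicat_real (A y) has_integral measure lebesgue (A y)) S"
      by (metis has_integral_restrict_UNIV)
    moreover have "measure (lebesgue_on S) (A y) = measure lebesgue (A y)"
      by (rule measure_restrict_space) (use S' in \<open>auto simp: A_def\<close>)
    ultimately show "(indicat_real (A y) has_integral measure (lebesgue_on S) (A y)) S"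
      by simp
  qed
  then show ?thesis
  proof (rule has_integral_eq_rhs[OF has_integral_eq, rotated])
    show "(\<Sum>y\<in>s ` S. indicat_real (A y) x *\<^sub>R y) = s x" if "x \<in> S" for x
    proof -
      have "(\<Sum>y\<in>s ` S. indicat_real (A y) x *\<^sub>R y) = (\<Sum>y\<in>s ` S. if y = s x then y else 0)"
        using that by (intro sum.cong) (auto simp: A_def)
      then show ?thesis using that fin by simp
    qed
  qed (simp add: Bochner_Integration.simple_bochner_integral_def A_def)
qed

text \<open>On any tagged division the Riemann sums of \<open>f\<close> and \<open>s i\<close>
  differ by at most the Riemann sum of the scalar majorant \<open>u i\<close>, which is close to the
  small number \<open>U i\<close>. So \<open>i\<close> is fixed first, and then one gauge serves
  both \<open>s i\<close> and \<open>u i\<close>.\<close>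

lemma has_integral_limit_L1:
  fixes f :: "real \<Rightarrow> 'a::banach"
  assumes s: "\<And>i. (s i has_integral I i) {a..b}"
    and u: "\<And>i. (u i has_integral U i) {a..b}"
    and le: "\<And>i x. x \<in> {a..b} \<Longrightarrow> norm (f x - s i x) \<le> u i x"
    and U: "U \<longlonglongrightarrow> 0" and I: "I \<longlonglongrightarrow> x"
  shows "(f has_integral x) {a..b}"
  unfolding has_integral_real
proof (intro allI impI)
  fix e :: real assume "e > 0"
  then have e: "e/4 > 0" by simp
  have "\<forall>\<^sub>F i in sequentially. dist (U i) 0 < e/4 \<and> dist (I i) x < e/4"
    using tendstoD[OF U e] tendstoD[OF I e] by (rule eventually_conj)
  then obtain i where i: "dist (U i) 0 < e/4" "dist (I i) x < e/4"
    by (auto simp: eventually_sequentially)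
  obtain g1 where g1: "gauge g1" "\<And>D. D tagged_division_of {a..b} \<Longrightarrow> g1 fine D \<Longrightarrow>
      norm ((\<Sum>(x,k)\<in>D. measure lborel k *\<^sub>R s i x) - I i) < e/4"
    using s[of i] e unfolding has_integral_real by metis
  obtain g2 where g2: "gauge g2" "\<And>D. D tagged_division_of {a..b} \<Longrightarrow> g2 fine D \<Longrightarrow>
      norm ((\<Sum>(x,k)\<in>D. measure lborel k *\<^sub>R u i x) - U i) < e/4"
    using u[of i] e unfolding has_integral_real by metis
  show "\<exists>\<gamma>. gauge \<gamma> \<and> (\<forall>D. D tagged_division_of {a..b} \<and> \<gamma> fine D \<longrightarrow>
      norm ((\<Sum>(x,k)\<in>D. measure lborel k *\<^sub>R f x) - x) < e)"
  proof (intro exI conjI allI impI)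
    show "gauge (\<lambda>x. g1 x \<inter> g2 x)" using g1 g2 by (simp add: gauge_Int)
    fix D assume D: "D tagged_division_of {a..b} \<and> (\<lambda>x. g1 x \<inter> g2 x) fine D"
    then have Dt: "D tagged_division_of {a..b}" and fine: "g1 fine D" "g2 fine D"
      by (auto simp: fine_Int)
    note 1 = g1(2)[OF Dt fine(1)] and 2 = g2(2)[OF Dt fine(2)]
    have "norm ((\<Sum>(x,k)\<in>D. measure lborel k *\<^sub>R f x) - (\<Sum>(x,k)\<in>D. measure lborel k *\<^sub>R s i x))
        = norm (\<Sum>(x,k)\<in>D. measure lborel k *\<^sub>R (f x - s i x))"
      by (simp add: sum_subtractf[symmetric] split_def scaleR_diff_right)
    also have "\<dots> \<le> (\<Sum>(x,k)\<in>D. measure lborel k *\<^sub>R u i x)"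
    proof (rule sum_norm_le)
      fix z assume "z \<in> D"
      then obtain x k where z: "z = (x,k)" "x \<in> {a..b}"
        using tagged_division_ofD(2,3)[OF Dt] by (cases z) blast
      then show "norm (case z of (x, k) \<Rightarrow> measure lborel k *\<^sub>R (f x - s i x)) \<le> (case z of (x, k) \<Rightarrow> measure lborel k *\<^sub>R u i x)"
        using le[OF z(2), of i] by (simp add: mult_left_mono)
    qed
    finally have 3: "norm ((\<Sum>(x,k)\<in>D. measure lborel k *\<^sub>R f x) - (\<Sum>(x,k)\<in>D. measure lborel k *\<^sub>R s i x))
      \<le> (\<Sum>(x,k)\<in>D. measure lborel k *\<^sub>R u i x)" .
    have "norm ((\<Sum>(x,k)\<in>D. measure lborel k *\<^sub>R f x) - x) \<le>
       norm ((\<Sum>(x,k)\<in>D. measure lborel k *\<^sub>R f x) - (\<Sum>(x,k)\<in>D. measure lborel k *\<^sub>R s i x))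
       + norm ((\<Sum>(x,k)\<in>D. measure lborel k *\<^sub>R s i x) - I i) + norm (I i - x)"
      by norm
    also have "\<dots> < e"
    proof -
      have "U i < e/4" "norm (I i - x) < e/4"
        using i by (auto simp: dist_norm)
      moreover have "(\<Sum>(x,k)\<in>D. measure lborel k *\<^sub>R u i x) < U i + e/4"
        using 2 unfolding real_norm_def by linarith
      ultimately show ?thesis using 1 3 by linarith
    qed
    finally show "norm ((\<Sum>(x,k)\<in>D. measure lborel k *\<^sub>R f x) - x) < e" .
  qed
qed

text \<open>For a nonseparable target, differences of Borel functions need not be Borel; here the
  subtrahend has finite range.\<close>
lemma borel_measurable_norm_diff_simple:
  fixes f :: "'b \<Rightarrow> 'a::real_normed_vector"
  assumes f: "f \<in> borel_measurable M" and s: "simple_function M s"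
  shows "(\<lambda>x. norm (f x - s x)) \<in> borel_measurable M"
proof (rule measurable_compose_countable'[where f="\<lambda>y x. norm (f x - y)" and g=s and I="s ` space M"])
  show "(\<lambda>x. norm (f x - y)) \<in> borel_measurable M" for y
    by (rule measurable_compose[OF f]) (intro borel_measurable_continuous_onI continuous_intros)
  show "s \<in> M \<rightarrow>\<^sub>M count_space (s ` space M)"
    using s by (auto simp: measurable_def simple_function_def)
      (metis (no_types, lifting) simple_functionD(2) s)
  show "countable (s ` space M)"
    using simple_functionD(1)[OF s] by (rule countable_finite)
qed

text \<open>The simple functions of the Bochner definition converge to \<open>f\<close> in L1; the
  norms of the errors serve as the majorants in \<open>has_integral_limit_L1\<close>.\<close>

lemma has_bochner_int_imp_has_integral:
  fixes f :: "real \<Rightarrow> 'a::banach"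
  assumes S: "S \<in> sets lebesgue" "S \<subseteq> {a..b}"
    and f: "has_bochner_int (lebesgue_on S) f x"
  shows "(f has_integral x) S"
  using f
proof cases
  case (1 s)
  let ?M = "lebesgue_on S"
  have Sm: "S \<in> lmeasurable"
    by (rule bounded_set_imp_lmeasurable[OF bounded_subset[OF bounded_closed_interval S(2)] S(1)])
  have meas: "(\<lambda>x. norm (f x - s i x)) \<in> borel_measurable ?M" for i
    using 1(1,2) by (auto intro: borel_measurable_norm_diff_simple
        elim: Bochner_Integration.simple_bochner_integrable.cases)
  \<comment> \<open>The first few L1 errors may be infinite; shifting by \<open>N\<close> leaves
    only errors with integral below 1.\<close>
  have "\<forall>\<^sub>F i in sequentially. (\<integral>\<^sup>+ y. ennreal (norm (f y - s i y)) \<partial>?M) < 1"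
    using 1(3) by (rule order_tendstoD) simp
  then obtain N where N: "(\<integral>\<^sup>+ y. ennreal (norm (f y - s i y)) \<partial>?M) < 1" if "i \<ge> N" for i
    by (auto simp: eventually_sequentially)
  have int: "integrable ?M (\<lambda>x. norm (f x - s (i + N) x))" for i
    using N[of "i+N"] meas by (simp add: integrable_iff_bounded) (meson ennreal_one_less_top order_less_trans)
  define U where "U i = integral\<^sup>L ?M (\<lambda>x. norm (f x - s (i + N) x))" for i
  have Ueq: "U = (\<lambda>i. enn2real (\<integral>\<^sup>+ y. ennreal (norm (f y - s (i + N) y)) \<partial>?M))"
    unfolding U_def by (intro ext integral_eq_nn_integral meas) auto
  have U: "U \<longlonglongrightarrow> 0"
    unfolding Ueq by (rule tendsto_enn2real) (use LIMSEQ_ignore_initial_segment[OF 1(3)] in simp_all)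
  have "((\<lambda>x. if x \<in> S then f x else 0) has_integral x) {a..b}"
  proof (rule has_integral_limit_L1)
    show "((\<lambda>x. if x \<in> S then s (i + N) x else 0) has_integral
      Bochner_Integration.simple_bochner_integral ?M (s (i + N))) {a..b}" for i
      using simple_bochner_integrable_has_integral[OF Sm 1(2)] S by simp
    show "((\<lambda>x. if x \<in> S then norm (f x - s (i + N) x) else 0) has_integral U i) {a..b}" for i
      unfolding U_def using has_integral_integral_lebesgue_on[OF int S(1)] S by simp
    show "U \<longlonglongrightarrow> 0" by fact
    show "(\<lambda>i. Bochner_Integration.simple_bochner_integral ?M (s (i + N))) \<longlonglongrightarrow> x"
      by (intro LIMSEQ_ignore_initial_segment 1(4))
  qed auto
  then show ?thesis using S by simp
qed

text \<open>Rounding down to the grid of mesh \<open>1 / Suc i\<close> can leave the interval only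
  at its left end, which is why \<open>q\<close> is clipped at \<open>a\<close> alone.\<close>

lemma floor_div_dist:
  fixes t :: real and i :: nat
  assumes "t \<in> {a..b}"
  defines "q \<equiv> max a (\<lfloor>real (Suc i) * t\<rfloor> / real (Suc i))"
  shows "q \<in> {a..b}" "dist q t \<le> inverse (real (Suc i))"
proof -
  have "\<lfloor>real (Suc i) * t\<rfloor> / real (Suc i) \<le> t"
    by (subst pos_divide_le_eq) (simp, metis mult.commute of_int_floor_le)
  moreover have "t - inverse (real (Suc i)) \<le> \<lfloor>real (Suc i) * t\<rfloor> / real (Suc i)"
  proof -
    have "t * real (Suc i) - 1 \<le> \<lfloor>real (Suc i) * t\<rfloor>"
      by (simp add: mult.commute)
    then have "(t - inverse (real (Suc i))) * real (Suc i) \<le> \<lfloor>real (Suc i) * t\<rfloor>"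
      by (simp add: left_diff_distrib)
    then show ?thesis by (subst pos_le_divide_eq) simp_all
  qed
  ultimately show "q \<in> {a..b}" "dist q t \<le> inverse (real (Suc i))"
    using assms(1) by (auto simp: q_def dist_real_def max_def abs_if)
qed

text \<open>Approximate the weight \<open>w\<close> by simple functions \<open>\<sigma> i\<close>
  and sample \<open>f\<close> at the rounded point \<open>q i t\<close>. The product is simple, and
  its L1 error is controlled by the modulus of continuity of \<open>f\<close> at the mesh size and
  the L1 error of \<open>\<sigma> i\<close>.\<close>

lemma has_bochner_int_scaleR_continuous:
  fixes f :: "real \<Rightarrow> 'a::banach"
  assumes S: "S \<in> sets lebesgue" "S \<subseteq> {a..b}"
    and w: "integrable (lebesgue_on S) w" and f: "continuous_on {a..b} f"
  obtains x where "has_bochner_int (lebesgue_on S) (\<lambda>t. w t *\<^sub>R f t) x"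
proof -
  let ?M = "lebesgue_on S"
  have Sm: "S \<in> lmeasurable"
    by (rule bounded_set_imp_lmeasurable[OF bounded_subset[OF bounded_closed_interval S(2)] S(1)])
  have sp [simp]: "space ?M = S" using S by auto
  have [measurable]: "w \<in> borel_measurable ?M" using w by auto
  obtain z \<sigma> where \<sigma>: "\<And>i. Bochner_Integration.simple_bochner_integrable ?M (\<sigma> i)"
    "(\<lambda>i. \<integral>\<^sup>+ y. ennreal (norm (w y - \<sigma> i y)) \<partial>?M) \<longlonglongrightarrow> 0"
    using w by (auto simp: integrable.simps has_bochner_integral.simps)
  have [measurable]: "\<sigma> i \<in> borel_measurable ?M" for i
    using \<sigma>(1) by (auto intro: borel_measurable_simple_function elim: Bochner_Integration.simple_bochner_integrable.cases)
  define q where "q i t = max a (\<lfloor>real (Suc i) * t\<rfloor> / real (Suc i))" for i t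
  have [measurable]: "q i \<in> borel_measurable ?M" for i
  proof -
    have "q i \<in> borel_measurable borel"
      unfolding q_def by measurable
    then show ?thesis
      by (simp add: measurable_completion measurable_restrict_space1 measurable_lborel1)
  qed
  have qsf: "simple_function ?M (q i)" for i
  proof (rule simple_function_borel_measurable)
    have "q i ` space ?M \<subseteq> (\<lambda>k. max a (of_int k / real (Suc i))) ` {\<lfloor>real (Suc i) * a\<rfloor>..\<lfloor>real (Suc i) * b\<rfloor>}"
    proof
      fix y assume "y \<in> q i ` space ?M"
      then obtain t where t: "t \<in> {a..b}" "y = q i t" using S by auto
      then have "\<lfloor>real (Suc i) * t\<rfloor> \<in> {\<lfloor>real (Suc i) * a\<rfloor>..\<lfloor>real (Suc i) * b\<rfloor>}"
        by (auto intro!: floor_mono mult_left_mono)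
      then show "y \<in> (\<lambda>k. max a (of_int k / real (Suc i))) ` {\<lfloor>real (Suc i) * a\<rfloor>..\<lfloor>real (Suc i) * b\<rfloor>}"
        using t by (auto simp: q_def)
    qed
    then show "finite (q i ` space ?M)"
      using finite_subset by blast
  qed measurable
  have q: "q i t \<in> {a..b}" "dist (q i t) t \<le> inverse (real (Suc i))" if "t \<in> S" for i t
    using floor_div_dist[of t a b i] that S by (auto simp: q_def)
  obtain B where B: "B > 0" "\<And>t. t \<in> {a..b} \<Longrightarrow> norm (f t) \<le> B"
    using compact_imp_bounded[OF compact_continuous_image[OF f compact_Icc]]
    by (auto simp: bounded_pos)
  have uc: "uniformly_continuous_on {a..b} f"
    using f compact_uniformly_continuous by blast
  have int\<sigma>: "integrable ?M (\<sigma> i)" for i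
    using \<sigma>(1) by (rule integrable.intros[OF has_bochner_integral_simple_bochner_integrable])
  define W where "W i = integral\<^sup>L ?M (\<lambda>t. norm (w t - \<sigma> i t))" for i
  have W: "W \<longlonglongrightarrow> 0"
  proof -
    have "W = (\<lambda>i. enn2real (\<integral>\<^sup>+ y. ennreal (norm (w y - \<sigma> i y)) \<partial>?M))"
      unfolding W_def by (intro ext integral_eq_nn_integral) auto
    moreover have "(\<lambda>i. enn2real (\<integral>\<^sup>+ y. ennreal (norm (w y - \<sigma> i y)) \<partial>?M)) \<longlonglongrightarrow> 0"
      by (rule tendsto_enn2real) (use \<sigma>(2) in simp_all)
    ultimately show ?thesis by simp
  qed
  \<comment> \<open>The largest change of \<open>f\<close> under rounding on \<open>S\<close>; for
    empty \<open>S\<close> the supremum carries no information, so 0 is prescribed.\<close>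
  define \<omega> where "\<omega> i = (if S = {} then 0 else SUP t\<in>S. norm (f t - f (q i t)))" for i
  have bdd: "bdd_above ((\<lambda>t. norm (f t - f (q i t))) ` S)" for i
  proof (rule bdd_aboveI2[of _ _ "2*B"])
    fix t assume t: "t \<in> S"
    show "norm (f t - f (q i t)) \<le> 2 * B"
      using B(2)[OF subsetD[OF S(2) t]] B(2)[OF q(1)[OF t]] norm_triangle_ineq4[of "f t" "f (q i t)"]
      by (smt (verit))
  qed
  have \<omega>: "norm (f t - f (q i t)) \<le> \<omega> i" if "t \<in> S" for t i
    using cSUP_upper[OF that bdd] that by (auto simp: \<omega>_def)
  \<comment> \<open>The two terms of \<open>u\<close> come from replacing first \<open>f t\<close>
    by \<open>f (q i t)\<close> and then \<open>w\<close> by \<open>\<sigma> i\<close>.\<close>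
  define u where "u i t = \<bar>w t\<bar> * \<omega> i + \<bar>w t - \<sigma> i t\<bar> * B" for i t
  define U where "U i = integral\<^sup>L ?M (\<lambda>t. \<bar>w t\<bar>) * \<omega> i + W i * B" for i
  define s where "s i t = \<sigma> i t *\<^sub>R f (q i t)" for i t
  have le: "norm (w t *\<^sub>R f t - s i t) \<le> u i t" if "t \<in> S" for i t
  proof -
    have "w t *\<^sub>R f t - s i t = w t *\<^sub>R (f t - f (q i t)) + (w t - \<sigma> i t) *\<^sub>R f (q i t)"
      by (simp add: s_def algebra_simps)
    then have "norm (w t *\<^sub>R f t - s i t) \<le> \<bar>w t\<bar> * norm (f t - f (q i t)) + \<bar>w t - \<sigma> i t\<bar> * norm (f (q i t))"
      by (metis norm_scaleR norm_triangle_ineq)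
    also have "\<dots> \<le> u i t"
      unfolding u_def using \<omega>[OF that] B(2)[OF q(1)[OF that]] by (intro add_mono mult_left_mono) auto
    finally show ?thesis .
  qed
  have intu: "integrable ?M (u i)" for i
    unfolding u_def using w int\<sigma> by auto
  have Uu: "integral\<^sup>L ?M (u i) = U i" for i
    unfolding U_def u_def W_def real_norm_def using w int\<sigma>[of i] by (subst Bochner_Integration.integral_add) auto
  have \<omega>0: "\<omega> \<longlonglongrightarrow> 0"
  proof (cases "S = {}")
    case True then show ?thesis by (simp add: \<omega>_def[abs_def])
  next
    case False
    show ?thesis
    proof (rule metric_LIMSEQ_I)
      fix e :: real assume "e > 0"
      then have "e/2 > 0" by simp
      with uc obtain d where d: "d > 0"
        "\<And>x y. x \<in> {a..b} \<Longrightarrow> y \<in> {a..b} \<Longrightarrow> dist y x < d \<Longrightarrow> dist (f y) (f x) < e/2"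
        unfolding uniformly_continuous_on_def by blast
      obtain N where N: "inverse (real (Suc N)) < d" using d(1) reals_Archimedean by blast
      have "dist (\<omega> n) 0 < e" if "n \<ge> N" for n
      proof -
        have "inverse (real (Suc n)) \<le> inverse (real (Suc N))"
          using that by (intro le_imp_inverse_le) auto
        with N have "inverse (real (Suc n)) < d" by linarith
        then have "dist (q n t) t < d" if "t \<in> S" for t
          using q(2)[OF that, of n] by linarith
        then have "norm (f t - f (q n t)) \<le> e/2" if "t \<in> S" for t
          using d(2)[OF subsetD[OF S(2) that] q(1)[OF that]] that
          by (simp add: dist_norm norm_minus_commute less_imp_le)
        with False have "(SUP t\<in>S. norm (f t - f (q n t))) \<le> e/2" by (rule cSUP_least)
        then have "\<omega> n \<le> e/2" using False by (simp add: \<omega>_def)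
        moreover obtain t where "t \<in> S" using False by auto
        then have "0 \<le> \<omega> n" by (rule order_trans[OF norm_ge_zero \<omega>])
        ultimately show ?thesis using \<open>e > 0\<close> by simp
      qed
      then show "\<exists>N. \<forall>n\<ge>N. dist (\<omega> n) 0 < e" by blast
    qed
  qed
  have U0: "U \<longlonglongrightarrow> 0"
    unfolding U_def
    using tendsto_add[OF tendsto_mult_left[OF \<omega>0] tendsto_mult_right[OF W]] by simp
  have sint: "Bochner_Integration.simple_bochner_integrable ?M (s i)" for i
  proof (rule Bochner_Integration.simple_bochner_integrable.intros)
    have "simple_function ?M (\<sigma> i)"
      using \<sigma>(1) by (auto elim: Bochner_Integration.simple_bochner_integrable.cases)
    then show "simple_function ?M (s i)"
      unfolding s_def by (rule simple_function_compose2[OF _ qsf])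
    show "emeasure ?M {y \<in> space ?M. s i y \<noteq> 0} \<noteq> \<infinity>"
      using finite_measure.emeasure_finite[OF finite_measure_lebesgue_on[OF Sm]] by simp
  qed
  define I where "I i = Bochner_Integration.simple_bochner_integral ?M (s i)" for i
  have sI: "(s i has_integral I i) S" for i
    unfolding I_def using simple_bochner_integrable_has_integral[OF Sm sint] .
  \<comment> \<open>Both \<open>s i\<close> and \<open>s j\<close> are compared with the common
    target \<open>w t *\<^sub>R f t\<close>. Since \<open>U\<close> tends to 0, the integrals form a
    Cauchy sequence, and completeness supplies the value of the Bochner integral.\<close>
  have dI: "norm (I i - I j) \<le> U i + U j" for i j
  proof -
    have "norm (integral S (\<lambda>t. s i t - s j t)) \<le> integral S (\<lambda>t. u i t + u j t)"
    proof (rule Henstock_Kurzweil_Integration.integral_norm_bound_integral)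
      show "(\<lambda>t. s i t - s j t) integrable_on S"
        by (intro integrable_diff has_integral_integrable[OF sI])
      show "(\<lambda>t. u i t + u j t) integrable_on S"
        by (intro integrable_add has_integral_integrable[OF has_integral_integral_lebesgue_on[OF intu S(1)]])
      show "norm (s i t - s j t) \<le> u i t + u j t" if "t \<in> S" for t
      proof -
        have "s i t - s j t = (w t *\<^sub>R f t - s j t) - (w t *\<^sub>R f t - s i t)" by simp
        then have "norm (s i t - s j t) \<le> norm (w t *\<^sub>R f t - s j t) + norm (w t *\<^sub>R f t - s i t)"
          by (metis norm_triangle_ineq4)
        with le[OF that, of i] le[OF that, of j] show ?thesis by linarith
      qed
    qed
    moreover have "integral S (\<lambda>t. u i t + u j t) = U i + U j"
      unfolding Uu[symmetric]
      by (rule integral_unique, rule has_integral_add; rule has_integral_integral_lebesgue_on[OF intu S(1)])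
    moreover have "integral S (\<lambda>t. s i t - s j t) = I i - I j"
      by (rule integral_unique, rule has_integral_diff; rule sI)
    ultimately show ?thesis by simp
  qed
  have "Cauchy I"
  proof (rule metric_CauchyI)
    fix e :: real assume "e > 0"
    then obtain N where N: "\<And>n. n \<ge> N \<Longrightarrow> dist (U n) 0 < e/2"
      using U0 metric_LIMSEQ_D[of U 0 "e/2"] by auto
    have "dist (I m) (I n) < e" if "m \<ge> N" "n \<ge> N" for m n
      using dI[of m n] N[OF that(1)] N[OF that(2)] by (simp add: dist_norm)
    then show "\<exists>N. \<forall>m\<ge>N. \<forall>n\<ge>N. dist (I m) (I n) < e" by blast
  qed
  then obtain x where x: "I \<longlonglongrightarrow> x"
    using Cauchy_convergent_iff convergent_def by blast
  show thesis
  proof (rule that[of x], rule has_bochner_int.intros)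
    show "(\<lambda>t. w t *\<^sub>R f t) \<in> borel_measurable ?M"
    proof -
      \<comment> \<open>The product is a continuous function of the pair \<open>(w t, t)\<close> in
        the plane; clamping the argument of \<open>f\<close> to \<open>{a..b}\<close> makes that
        function continuous everywhere.\<close>
      let ?g = "\<lambda>p. fst p *\<^sub>R f (max a (min b (snd p)))"
      show ?thesis
      proof (cases "S = {}")
        case False
        then obtain t where "t \<in> {a..b}" using S by blast
        then have ab: "a \<le> b" by simp
        have "continuous_on UNIV (\<lambda>p::real\<times>real. f (max a (min b (snd p))))"
          by (rule continuous_on_compose2[OF f]) (use ab in \<open>auto intro!: continuous_intros\<close>)
        then have "continuous_on UNIV ?g"
          by (intro continuous_intros)
        then have g: "?g \<in> borel_measurable borel" by (rule borel_measurable_continuous_onI)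
        have "(\<lambda>t. t) \<in> borel_measurable ?M"
          by (simp add: measurable_completion measurable_restrict_space1 measurable_lborel1)
        then have "(\<lambda>t. (w t, t)) \<in> borel_measurable ?M"
          by (intro borel_measurable_Pair) auto
        from measurable_compose[OF this g]
        have "(\<lambda>t. w t *\<^sub>R f (max a (min b t))) \<in> borel_measurable ?M" by simp
        then show ?thesis
          by (rule measurable_cong[THEN iffD1, rotated]) (use S in \<open>auto simp: max_def min_def\<close>)
      qed (auto simp: measurable_def)
    qed
    show "(\<lambda>i. \<integral>\<^sup>+ y. ennreal (norm (w y *\<^sub>R f y - s i y)) \<partial>?M) \<longlonglongrightarrow> 0"
    proof (rule tendsto_sandwich[OF _ _ tendsto_const])
      show "\<forall>\<^sub>F i in sequentially. (\<integral>\<^sup>+ y. ennreal (norm (w y *\<^sub>R f y - s i y)) \<partial>?M) \<le> ennreal (U i)"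
      proof (rule always_eventually, rule allI)
        fix i
        have "(\<integral>\<^sup>+ y. ennreal (norm (w y *\<^sub>R f y - s i y)) \<partial>?M) \<le> (\<integral>\<^sup>+ y. ennreal (u i y) \<partial>?M)"
          using le by (intro nn_integral_mono ennreal_leI) auto
        also have "\<dots> = ennreal (U i)"
          unfolding Uu[symmetric] using intu
        proof (rule nn_integral_eq_integral)
          show "AE t in ?M. 0 \<le> u i t"
            by (rule AE_I2, rule order_trans[OF norm_ge_zero le]) simp
        qed
        finally show "(\<integral>\<^sup>+ y. ennreal (norm (w y *\<^sub>R f y - s i y)) \<partial>?M) \<le> ennreal (U i)" .
      qed
      show "(\<lambda>i. ennreal (U i)) \<longlonglongrightarrow> 0"
        using tendsto_ennrealI[OF U0] by simp
    qed auto
  qed (use sint x in \<open>auto simp: I_def[abs_def]\<close>)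
qed

lemma
  fixes f :: "real \<Rightarrow> 'a::banach"
  assumes S: "S \<in> sets lebesgue" "S \<subseteq> {a..b}"
    and w: "integrable (lebesgue_on S) w" and f: "continuous_on {a..b} f"
  shows bochner_integrable_scaleR_continuous: "bochner_integrable (lebesgue_on S) (\<lambda>t. w t *\<^sub>R f t)"
    and scaleR_continuous_has_integral:
      "((\<lambda>t. w t *\<^sub>R f t) has_integral bochner_int (lebesgue_on S) (\<lambda>t. w t *\<^sub>R f t)) S"
proof -
  obtain x where x: "has_bochner_int (lebesgue_on S) (\<lambda>t. w t *\<^sub>R f t) x"
    using has_bochner_int_scaleR_continuous[OF S w f] .
  then show *: "bochner_integrable (lebesgue_on S) (\<lambda>t. w t *\<^sub>R f t)"
    by (auto simp: bochner_integrable_def)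
  \<comment> \<open>A Bochner integral on \<open>S\<close> is also a gauge integral, so its value is
    unique and \<open>THE\<close> selects it.\<close>
  have "(THE y. has_bochner_int (lebesgue_on S) (\<lambda>t. w t *\<^sub>R f t) y) = x"
  proof (rule the_equality)
    fix y assume "has_bochner_int (lebesgue_on S) (\<lambda>t. w t *\<^sub>R f t) y"
    from has_bochner_int_imp_has_integral[OF S this] has_bochner_int_imp_has_integral[OF S x]
    show "y = x" by (rule has_integral_unique)
  qed (rule x)
  then have "bochner_int (lebesgue_on S) (\<lambda>t. w t *\<^sub>R f t) = x"
    using * by (simp add: bochner_int_def)
  then show "((\<lambda>t. w t *\<^sub>R f t) has_integral bochner_int (lebesgue_on S) (\<lambda>t. w t *\<^sub>R f t)) S"
    using has_bochner_int_imp_has_integral[OF S x] by simp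
qed

section \<open>Density of polynomials\<close>

text \<open>Bernstein's probabilistic argument works for vector values: the weights
  \<open>Bernstein n k t\<close> are nonnegative, sum to 1, and have mean \<open>t\<close> and
  variance at most \<open>1 / n\<close> in the variable \<open>k / n\<close>.\<close>

lemma Bernstein_uniform_limit:
  fixes f :: "real \<Rightarrow> 'a::real_normed_vector"
  assumes f: "continuous_on {0..1} f"
  shows "uniform_limit {0..1} (\<lambda>n t. \<Sum>k\<le>n. Bernstein n k t *\<^sub>R f (real k / real n)) f sequentially"
proof (rule uniform_limitI)
  fix e :: real assume e: "e > 0"
  obtain B where B: "B > 0" "\<And>t. t \<in> {0..1} \<Longrightarrow> norm (f t) \<le> B"
    using compact_imp_bounded[OF compact_continuous_image[OF f compact_Icc]]
    by (auto simp: bounded_pos)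
  have "uniformly_continuous_on {0..1} f"
    using f compact_uniformly_continuous by blast
  moreover have "e/2 > 0" using e by simp
  ultimately obtain d where d: "d > 0"
    "\<And>x y. x \<in> {0..1} \<Longrightarrow> y \<in> {0..1} \<Longrightarrow> dist y x < d \<Longrightarrow> dist (f y) (f x) < e/2"
    unfolding uniformly_continuous_on_def by blast
  \<comment> \<open>Near points use uniform continuity, and distant points the bound
    \<open>2 * B\<close> together with \<open>(s - t)\<^sup>2 / d\<^sup>2 \<ge> 1\<close>.\<close>
  have mod: "norm (f s - f t) \<le> e/2 + 2 * B / d\<^sup>2 * (s - t)\<^sup>2" if "s \<in> {0..1}" "t \<in> {0..1}" for s t
  proof (cases "dist s t < d")
    case True
    then have "norm (f s - f t) \<le> e/2" using d(2)[OF that(2,1)] by (simp add: dist_norm)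
    moreover have "0 \<le> 2 * B / d\<^sup>2 * (s - t)\<^sup>2" using B by simp
    ultimately show ?thesis by linarith
  next
    case False
    then have "d\<^sup>2 \<le> (s - t)\<^sup>2"
      using d(1) by (subst abs_le_square_iff[symmetric]) (simp add: dist_real_def)
    then have "1 \<le> (s - t)\<^sup>2 / d\<^sup>2" using d(1) by simp
    then have "2 * B * 1 \<le> 2 * B * ((s - t)\<^sup>2 / d\<^sup>2)"
      using B by (intro mult_left_mono) auto
    moreover have "norm (f s - f t) \<le> 2 * B"
      using B(2)[OF that(1)] B(2)[OF that(2)] norm_triangle_ineq4[of "f s" "f t"] by linarith
    ultimately show ?thesis using e by simp
  qed
  \<comment> \<open>Chosen so that the variance contribution \<open>2 * B / (d\<^sup>2 * n)\<close>
    is below \<open>e / 2\<close>.\<close>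
  define N where "N = nat \<lceil>4 * B / (d\<^sup>2 * e)\<rceil> + 1"
  have "dist (\<Sum>k\<le>n. Bernstein n k t *\<^sub>R f (real k / real n)) (f t) < e"
    if n: "n \<ge> N" and t: "t \<in> {0..1}" for n t
  proof -
    have n0: "n > 0" using n by (simp add: N_def)
    have Bn: "Bernstein n k t \<ge> 0" for k using t by (simp add: Bernstein_nonneg)
    have var: "(\<Sum>k\<le>n. Bernstein n k t * (real k / real n - t)\<^sup>2) = t * (1 - t) / n"
    proof -
      \<comment> \<open>The square is rewritten in terms of \<open>k * (k - 1)\<close>,
        \<open>k\<close> and 1, whose sums against the Bernstein weights are known in closed
        form.\<close>
      have *: "Bernstein n k t * (real k / real n - t)\<^sup>2 = (real k * (real k - 1) * Bernstein n k t
          + (1 - 2 * n * t) * (real k * Bernstein n k t) + (n * t)\<^sup>2 * Bernstein n k t) / n\<^sup>2" for k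
        using n0 by (simp add: field_simps power2_eq_square)
      show ?thesis
        unfolding * using n0
        by (simp add: sum.distrib sum_divide_distrib[symmetric] sum_distrib_left[symmetric])
          (simp add: field_simps power2_eq_square)
    qed
    have "(\<Sum>k\<le>n. Bernstein n k t *\<^sub>R f (real k / real n)) - f t
        = (\<Sum>k\<le>n. Bernstein n k t *\<^sub>R (f (real k / real n) - f t))"
      by (simp add: scaleR_diff_right sum_subtractf scaleR_sum_left[symmetric])
    also have "norm \<dots> \<le> (\<Sum>k\<le>n. Bernstein n k t * (e/2 + 2 * B / d\<^sup>2 * (real k / real n - t)\<^sup>2))"
    proof (rule sum_norm_le)
      fix k assume "k \<in> {..n}"
      then have "real k / real n \<in> {0..1}" using n0 by auto
      from mult_left_mono[OF mod[OF this t] Bn]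
      show "norm (Bernstein n k t *\<^sub>R (f (real k / real n) - f t))
          \<le> Bernstein n k t * (e/2 + 2 * B / d\<^sup>2 * (real k / real n - t)\<^sup>2)"
        using Bn by simp
    qed
    also have "\<dots> = e/2 + 2 * B / d\<^sup>2 * (\<Sum>k\<le>n. Bernstein n k t * (real k / real n - t)\<^sup>2)"
      by (simp add: distrib_left sum.distrib sum_distrib_right[symmetric] sum_distrib_left
          sum_divide_distrib[symmetric] mult.left_commute)
    also have "\<dots> \<le> e/2 + 2 * B / d\<^sup>2 * (1 / n)"
      unfolding var using t B by (intro add_left_mono mult_left_mono divide_right_mono)
        (auto intro: mult_le_one)
    also have "\<dots> < e"
    proof -
      have "4 * B / (d\<^sup>2 * e) < n" using n unfolding N_def by linarith
      then have "4 * B < n * (d\<^sup>2 * e)" using d e by (simp add: pos_divide_less_eq)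
      then show ?thesis using d n0 by (simp add: field_simps)
    qed
    finally show ?thesis by (simp add: dist_norm)
  qed
  then show "\<forall>\<^sub>F n in sequentially. \<forall>t\<in>{0..1}.
      dist (\<Sum>k\<le>n. Bernstein n k t *\<^sub>R f (real k / real n)) (f t) < e"
    unfolding eventually_sequentially by blast
qed

text \<open>Bernstein polynomials of \<open>f\<close>, carried over to \<open>{a..b}\<close>, are
  finite sums of monomials with vector coefficients and converge uniformly to \<open>f\<close>.
  Properties preserved by sums and uniform limits therefore need checking on monomials only.\<close>

lemma continuous_on_Icc_induct [consumes 2, case_names monomial add limit]:
  fixes f :: "real \<Rightarrow> 'a::real_normed_vector"
  assumes ab: "a < b" and f: "continuous_on {a..b} f"
    and monomial: "\<And>j x. P (\<lambda>t. (t - a) ^ j *\<^sub>R x)"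
    and add: "\<And>f g. continuous_on {a..b} f \<Longrightarrow> continuous_on {a..b} g \<Longrightarrow> P f \<Longrightarrow> P g \<Longrightarrow>
      P (\<lambda>t. f t + g t)"
    and limit: "\<And>F f. (\<And>n. continuous_on {a..b} (F n)) \<Longrightarrow> continuous_on {a..b} f \<Longrightarrow>
      uniform_limit {a..b} F f sequentially \<Longrightarrow> (\<And>n. P (F n)) \<Longrightarrow> P f"
  shows "P f"
proof -
  have sum: "continuous_on {a..b} (\<lambda>t. \<Sum>i\<in>I. G i t) \<and> P (\<lambda>t. \<Sum>i\<in>I. G i t)"
    if "finite I" "\<And>i. i \<in> I \<Longrightarrow> continuous_on {a..b} (G i) \<and> P (G i)"
    for I :: "nat set" and G :: "nat \<Rightarrow> real \<Rightarrow> 'a"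
    using that
  proof (induction I)
    case empty
    then show ?case using monomial[of 0 0] by simp
  next
    case (insert i I)
    then show ?case by (auto intro!: add continuous_intros)
  qed
  define F where "F n t = (\<Sum>k\<le>n. Bernstein n k ((t - a) / (b - a)) *\<^sub>R f (a + (b - a) * (real k / real n)))" for n t
  have P: "continuous_on {a..b} (F n) \<and> P (F n)" for n
    unfolding F_def
  proof (rule sum)
    fix k assume "k \<in> {..n}"
    have "real_polynomial_function (\<lambda>u. Bernstein n k (u / (b - a)))"
      unfolding Bernstein_def divide_inverse
      by (intro real_polynomial_function.intros real_polynomial_function_power real_polynomial_function_diff)
        (auto intro: bounded_linear_ident)
    then obtain c m where c: "(\<lambda>u. Bernstein n k (u / (b - a))) = (\<lambda>u. \<Sum>i\<le>m. c i * u ^ i)"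
      by (auto simp: real_polynomial_function_iff_sum)
    let ?x = "f (a + (b - a) * (real k / real n))"
    have "(\<lambda>t. Bernstein n k ((t - a) / (b - a)) *\<^sub>R ?x) = (\<lambda>t. \<Sum>i\<le>m. (t - a) ^ i *\<^sub>R (c i *\<^sub>R ?x))"
      using fun_cong[OF c] by (simp add: scaleR_sum_left mult.commute)
    moreover have "continuous_on {a..b} (\<lambda>t. \<Sum>i\<le>m. (t - a) ^ i *\<^sub>R (c i *\<^sub>R ?x)) \<and>
        P (\<lambda>t. \<Sum>i\<le>m. (t - a) ^ i *\<^sub>R (c i *\<^sub>R ?x))"
      by (rule sum, simp, intro conjI monomial continuous_intros)
    ultimately show "continuous_on {a..b} (\<lambda>t. Bernstein n k ((t - a) / (b - a)) *\<^sub>R ?x) \<and>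
        P (\<lambda>t. Bernstein n k ((t - a) / (b - a)) *\<^sub>R ?x)"
      by (simp only:)
  qed simp
  have "continuous_on {0..1} (\<lambda>u. f (a + (b - a) * u))"
  proof (rule continuous_on_compose2[OF f])
    show "(\<lambda>u. a + (b - a) * u) ` {0..1} \<subseteq> {a..b}"
    proof clarify
      fix u :: real assume u: "u \<in> {0..1}"
      then have "(b - a) * u \<le> (b - a) * 1" "0 \<le> (b - a) * u"
        using ab by (intro mult_left_mono mult_nonneg_nonneg; simp)+
      then show "a + (b - a) * u \<in> {a..b}" by simp
    qed
  qed (intro continuous_intros)
  note lim = uniform_limitD[OF Bernstein_uniform_limit[OF this]]
  have "uniform_limit {a..b} F f sequentially"
  proof (rule uniform_limitI)
    fix e :: real assume "e > 0"
    from lim[OF this] show "\<forall>\<^sub>F n in sequentially. \<forall>t\<in>{a..b}. dist (F n t) (f t) < e"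
    proof eventually_elim
      case (elim n)
      show ?case
      proof
        fix t assume "t \<in> {a..b}"
        then have "(t - a) / (b - a) \<in> {0..1}" using ab by simp
        from elim[rule_format, OF this] show "dist (F n t) (f t) < e"
          using ab by (simp add: F_def)
      qed
    qed
  qed
  then show ?thesis using limit[of F f] P f by blast
qed

section \<open>Test functions and the lemma of du Bois-Reymond\<close>

definition smooth :: "(real \<Rightarrow> real) \<Rightarrow> bool" where
  "smooth f \<longleftrightarrow> (\<forall>n x. (deriv ^^ n) f differentiable (at x))"

text \<open>An invariant that implies differentiability and passes to the derivative is inherited by
  all iterated derivatives, so no formula for the n-th derivative is required.\<close>

lemma smooth_coinduct:
  assumes "Q f" and step: "\<And>g. Q g \<Longrightarrow> (\<forall>x. g differentiable (at x)) \<and> Q (deriv g)"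
  shows "smooth f"
proof -
  have "Q ((deriv ^^ n) f)" for n
    by (induction n) (use assms in auto)
  then show ?thesis using step by (auto simp: smooth_def)
qed

lemma smooth_higher_deriv: "smooth f \<Longrightarrow> smooth ((deriv ^^ n) f)"
  by (auto simp: smooth_def simp flip: funpow_add comp_apply[of "deriv ^^ _"])

lemma smooth_deriv: "smooth f \<Longrightarrow> smooth (deriv f)"
  using smooth_higher_deriv[of f 1] by simp

lemma smooth_has_real_derivative: "smooth f \<Longrightarrow> (f has_real_derivative deriv f x) (at x within S)"
proof -
  assume "smooth f"
  then have "(deriv ^^ 0) f differentiable (at x)" unfolding smooth_def by blast
  then show ?thesis
    by (auto simp: DERIV_deriv_iff_real_differentiable intro: has_field_derivative_at_within)
qed

lemma smooth_continuous_on: "smooth f \<Longrightarrow> continuous_on S f"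
  by (meson DERIV_continuous_on smooth_has_real_derivative)

text \<open>This combination serves both to subtract a multiple of a fixed bump and, with
  \<open>f\<close> zero, to rescale one.\<close>

lemma smooth_diff_mult:
  assumes "smooth f" "smooth g"
  shows "smooth (\<lambda>x. f x - c * g x)"
proof (rule smooth_coinduct[where Q="\<lambda>h. \<exists>f g. smooth f \<and> smooth g \<and> h = (\<lambda>x. f x - c * g x)"])
  fix h assume "\<exists>f g. smooth f \<and> smooth g \<and> h = (\<lambda>x. f x - c * g x)"
  then obtain f g where fg: "smooth f" "smooth g" "h = (\<lambda>x. f x - c * g x)" by blast
  have D: "(h has_real_derivative deriv f x - c * deriv g x) (at x)" for x
    unfolding fg(3) by (intro derivative_intros smooth_has_real_derivative fg DERIV_cmult)
  then have "deriv h = (\<lambda>x. deriv f x - c * deriv g x)"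
    using DERIV_imp_deriv by blast
  then show "(\<forall>x. h differentiable (at x)) \<and> (\<exists>f g. smooth f \<and> smooth g \<and> deriv h = (\<lambda>x. f x - c * g x))"
    using D fg smooth_deriv real_differentiable_def by blast
qed (use assms in auto)

lemma higher_deriv_diff_mult:
  assumes "smooth f" "smooth g"
  shows "(deriv ^^ n) (\<lambda>x. f x - c * g x) = (\<lambda>x. (deriv ^^ n) f x - c * (deriv ^^ n) g x)"
proof (induction n)
  case (Suc n)
  have "((\<lambda>x. (deriv ^^ n) f x - c * (deriv ^^ n) g x) has_real_derivative
      deriv ((deriv ^^ n) f) x - c * deriv ((deriv ^^ n) g) x) (at x)" for x
    by (intro derivative_intros smooth_has_real_derivative smooth_higher_deriv assms DERIV_cmult)
  then show ?case
    by (auto simp: Suc DERIV_imp_deriv)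
qed simp

text \<open>For a fixed \<open>q\<close>, this family is closed under differentiation.\<close>
definition flat_quotient :: "real poly \<Rightarrow> real poly \<Rightarrow> nat \<Rightarrow> real \<Rightarrow> real" where
  "flat_quotient q p k x =
    (if poly q x > 0 then poly p x * (1 / poly q x) ^ k * exp (- (1 / poly q x)) else 0)"

text \<open>Compare \<open>exp u\<close> with \<open>(1 + u / m) ^ m\<close> for
  \<open>m = k + 2\<close>. The two powers beyond \<open>k\<close> give the decay
  \<open>1 / u\<^sup>2\<close>, which makes flat quotients vanish to second order at the edge of
  their support.\<close>

lemma power_mult_exp_minus_le:
  fixes u :: real
  assumes "u > 0"
  shows "u ^ k * exp (- u) \<le> real (k + 2) ^ (k + 2) / u\<^sup>2"
proof -
  define K where "K = real (k + 2) ^ (k + 2)"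
  have "(u / real (k + 2)) ^ (k + 2) \<le> (1 + u / real (k + 2)) ^ (k + 2)"
    using assms by (intro power_mono) auto
  also have "\<dots> \<le> exp u"
    using exp_ge_one_plus_x_over_n_power_n[of "k + 2" u] assms by (simp add: field_simps)
  finally have "u ^ (k + 2) \<le> K * exp u"
    unfolding power_divide K_def by (subst (asm) pos_divide_le_eq) (simp_all add: mult.commute)
  then show ?thesis
    unfolding K_def[symmetric] using assms by (simp add: exp_minus field_simps power2_eq_square)
qed

text \<open>Where \<open>q\<close> is positive this is the product rule. At a point where
  \<open>q\<close> is not positive, the function is bounded by a multiple of
  \<open>(poly q y - poly q x)\<^sup>2\<close>, so its difference quotient tends to 0.\<close>

lemma flat_quotient_has_real_derivative:
  "(flat_quotient q p k has_real_derivative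
    flat_quotient q (pderiv p * q\<^sup>2 - of_nat k * p * pderiv q * q + p * pderiv q) (k + 2) x) (at x)"
proof (cases "poly q x > 0")
  case True
  let ?f = "\<lambda>y. poly p y * (1 / poly q y) ^ k * exp (- (1 / poly q y))"
  have "(?f has_real_derivative flat_quotient q (pderiv p * q\<^sup>2 - of_nat k * p * pderiv q * q + p * pderiv q) (k + 2) x) (at x)"
  proof -
    have "((\<lambda>y. (1 / poly q y) ^ k) has_real_derivative
        - (of_nat k * (1 / poly q x) ^ (k + 1) * poly (pderiv q) x)) (at x)"
    proof (cases k)
      case (Suc m)
      show ?thesis
        unfolding Suc using True
        by (auto intro!: derivative_eq_intros poly_DERIV) (cases m; simp add: field_simps)
    qed simp
    moreover have "((\<lambda>y. exp (- (1 / poly q y))) has_real_derivative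
        exp (- (1 / poly q x)) * ((1 / poly q x) ^ 2 * poly (pderiv q) x)) (at x)"
      using True by (auto intro!: derivative_eq_intros poly_DERIV simp: power2_eq_square)
    ultimately have "(?f has_real_derivative
        (poly (pderiv p) x * (1 / poly q x) ^ k
          + - (of_nat k * (1 / poly q x) ^ (k + 1) * poly (pderiv q) x) * poly p x) * exp (- (1 / poly q x))
        + exp (- (1 / poly q x)) * ((1 / poly q x) ^ 2 * poly (pderiv q) x) * (poly p x * (1 / poly q x) ^ k)) (at x)"
      by (intro DERIV_mult poly_DERIV)
    then show ?thesis
      by (rule DERIV_cong) (use True in \<open>simp add: flat_quotient_def field_simps power2_eq_square\<close>)
  qed
  moreover have "open {y. poly q y > 0}"
    by (intro open_Collect_less continuous_intros)
  ultimately show ?thesis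
    by (rule has_field_derivative_transform_within_open) (use True in \<open>auto simp: flat_quotient_def\<close>)
next
  case False
  let ?K = "real (k + 2) ^ (k + 2)"
  let ?g = "\<lambda>y. ?K * \<bar>poly p y\<bar> * \<bar>(poly q y - poly q x) / (y - x)\<bar> * \<bar>poly q y - poly q x\<bar>"
  have bound: "\<bar>flat_quotient q p k y\<bar> \<le> ?K * \<bar>poly p y\<bar> * (poly q y - poly q x)\<^sup>2" for y
  proof (cases "poly q y > 0")
    case True
    have "\<bar>flat_quotient q p k y\<bar> = \<bar>poly p y\<bar> * ((1 / poly q y) ^ k * exp (- (1 / poly q y)))"
      using True by (simp add: flat_quotient_def abs_mult)
    also have "\<dots> \<le> \<bar>poly p y\<bar> * (?K / (1 / poly q y)\<^sup>2)"
      using True by (intro mult_left_mono power_mult_exp_minus_le) auto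
    also have "\<dots> = ?K * \<bar>poly p y\<bar> * (poly q y)\<^sup>2"
      using True by (simp add: field_simps)
    \<comment> \<open>Here \<open>poly q x \<le> 0 < poly q y\<close>, so subtracting
      \<open>poly q x\<close> only enlarges the base.\<close>
    also have "\<dots> \<le> ?K * \<bar>poly p y\<bar> * (poly q y - poly q x)\<^sup>2"
      using True False by (intro mult_left_mono power_mono) auto
    finally show ?thesis .
  qed (simp add: flat_quotient_def)
  have "((\<lambda>y. (flat_quotient q p k y - flat_quotient q p k x) / (y - x)) \<longlongrightarrow> 0) (at x)"
  proof (rule Lim_null_comparison)
    show "\<forall>\<^sub>F y in at x. norm ((flat_quotient q p k y - flat_quotient q p k x) / (y - x)) \<le> ?g y"
      unfolding eventually_at_filter
    proof (intro always_eventually allI impI)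
      fix y assume "y \<noteq> x"
      have "norm ((flat_quotient q p k y - flat_quotient q p k x) / (y - x)) = \<bar>flat_quotient q p k y\<bar> / \<bar>y - x\<bar>"
        using False by (simp add: flat_quotient_def)
      also have "\<dots> \<le> (?K * \<bar>poly p y\<bar> * (poly q y - poly q x)\<^sup>2) / \<bar>y - x\<bar>"
        by (intro divide_right_mono bound) auto
      also have "\<dots> = ?g y"
        by (simp add: abs_divide power2_eq_square mult.assoc)
      finally show "norm ((flat_quotient q p k y - flat_quotient q p k x) / (y - x)) \<le> ?g y" .
    qed
    have "((\<lambda>y. (poly q y - poly q x) / (y - x)) \<longlongrightarrow> poly (pderiv q) x) (at x)"
      using poly_DERIV[of q x] by (simp add: has_field_derivative_iff)
    moreover have "((\<lambda>y. poly q y - poly q x) \<longlongrightarrow> poly q x - poly q x) (at x)"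
      by (intro tendsto_intros)
    moreover have "((\<lambda>y. poly p y) \<longlongrightarrow> poly p x) (at x)"
      by (intro tendsto_intros)
    ultimately have "(?g \<longlongrightarrow> ?K * \<bar>poly p x\<bar> * \<bar>poly (pderiv q) x\<bar> * \<bar>poly q x - poly q x\<bar>) (at x)"
      by (intro tendsto_mult tendsto_rabs tendsto_const)
    then show "(?g \<longlongrightarrow> 0) (at x)" by simp
  qed
  then show ?thesis
    using False by (simp add: has_field_derivative_iff flat_quotient_def)
qed

lemma smooth_flat_quotient: "smooth (flat_quotient q p k)"
proof (rule smooth_coinduct[where Q="\<lambda>f. \<exists>p k. f = flat_quotient q p k"])
  fix f assume "\<exists>p k. f = flat_quotient q p k"
  then obtain p k where "f = flat_quotient q p k" by blast
  then have D: "(f has_real_derivative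
    flat_quotient q (pderiv p * q\<^sup>2 - of_nat k * p * pderiv q * q + p * pderiv q) (k + 2) x) (at x)" for x
    using flat_quotient_has_real_derivative by simp
  then have "deriv f = flat_quotient q (pderiv p * q\<^sup>2 - of_nat k * p * pderiv q * q + p * pderiv q) (k + 2)"
    using DERIV_imp_deriv by blast
  then show "(\<forall>x. f differentiable (at x)) \<and> (\<exists>p k. deriv f = flat_quotient q p k)"
    using D real_differentiable_def by blast
qed auto

lemma ex_smooth_bump:
  fixes c d :: real
  assumes "c < d"
  obtains \<theta> where "smooth \<theta>" "\<And>x. \<theta> x \<ge> 0" "\<And>x. x \<notin> {c..d} \<Longrightarrow> \<theta> x = 0"
    "\<And>x. c < x \<Longrightarrow> x < d \<Longrightarrow> \<theta> x > 0"
proof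
  \<comment> \<open>The product of \<open>c - x\<close> and \<open>x - d\<close> is positive exactly
    strictly between \<open>c\<close> and \<open>d\<close>.\<close>
  define q where "q = [:c, -1:] * [:- d, 1:]"
  have q: "poly q x = (x - c) * (d - x)" for x
    by (simp add: q_def algebra_simps)
  show "smooth (flat_quotient q 1 0)" by (rule smooth_flat_quotient)
  show "flat_quotient q 1 0 x \<ge> 0" for x by (simp add: flat_quotient_def)
  show "flat_quotient q 1 0 x > 0" if "c < x" "x < d" for x
    using that by (simp add: flat_quotient_def q)
  show "flat_quotient q 1 0 x = 0" if "x \<notin> {c..d}" for x
    using that assms by (auto simp: flat_quotient_def q zero_less_mult_iff)
qed


section \<open>Test functions: antiderivatives and integration by parts\<close>

lemma test_function_altdef:
  "test_function a b \<phi> \<longleftrightarrow>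
    smooth \<phi> \<and> (\<exists>c d. a < c \<and> d < b \<and> (\<forall>x. x \<notin> {c..d} \<longrightarrow> \<phi> x = 0))"
  by (simp add: test_function_def smooth_def)

lemma test_function_0: "test_function a b (\<lambda>_. 0)"
proof -
  have "smooth (\<lambda>_. 0)"
    by (rule smooth_coinduct[where Q="\<lambda>f. f = (\<lambda>_. 0)"]) auto
  then show ?thesis
    unfolding test_function_altdef by simp (meson gt_ex lt_ex)
qed

lemma test_function_smooth: "test_function a b \<phi> \<Longrightarrow> smooth \<phi>"
  by (simp add: test_function_altdef)

lemma test_function_deriv:
  assumes "test_function a b \<phi>"
  shows "test_function a b (deriv \<phi>)"
proof -
  obtain c d where cd: "a < c" "d < b" "\<And>x. x \<notin> {c..d} \<Longrightarrow> \<phi> x = 0"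
    using assms by (auto simp: test_function_altdef)
  have "deriv \<phi> x = 0" if "x \<notin> {c..d}" for x
  proof (rule DERIV_imp_deriv)
    have "((\<lambda>_. 0) has_real_derivative 0) (at x)" by simp
    then show "(\<phi> has_real_derivative 0) (at x)"
      by (rule has_field_derivative_transform_within_open[where S="- {c..d}"]) (use that cd in auto)
  qed
  then show ?thesis
    using cd assms smooth_deriv unfolding test_function_altdef by blast
qed

lemma test_function_higher_deriv: "test_function a b \<phi> \<Longrightarrow> test_function a b ((deriv ^^ n) \<phi>)"
  by (induction n) (auto intro: test_function_deriv)

lemma test_function_eq_0:
  assumes "test_function a b \<phi>" "x \<le> a \<or> b \<le> x"
  shows "\<phi> x = 0"
proof -
  obtain c d where cd: "a < c" "d < b" "\<And>x. x \<notin> {c..d} \<Longrightarrow> \<phi> x = 0"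
    using assms by (auto simp: test_function_altdef)
  show ?thesis using assms(2) cd(1,2) by (intro cd(3)) auto
qed

lemma test_function_diff_mult:
  assumes "test_function a b \<phi>" "test_function a b \<psi>"
  shows "test_function a b (\<lambda>x. \<phi> x - k * \<psi> x)"
proof -
  obtain c d where cd: "a < c" "d < b" "\<And>x. x \<notin> {c..d} \<Longrightarrow> \<phi> x = 0"
    using assms by (auto simp: test_function_altdef)
  obtain c' d' where cd': "a < c'" "d' < b" "\<And>x. x \<notin> {c'..d'} \<Longrightarrow> \<psi> x = 0"
    using assms by (auto simp: test_function_altdef)
  have "\<phi> x - k * \<psi> x = 0" if "x \<notin> {min c c'..max d d'}" for x
  proof -
    have "x \<notin> {c..d}" "x \<notin> {c'..d'}" using that by auto
    then show ?thesis using cd(3) cd'(3) by simp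
  qed
  moreover have "a < min c c'" "max d d' < b" using cd cd' by auto
  ultimately show ?thesis
    using smooth_diff_mult assms unfolding test_function_altdef by blast
qed

text \<open>The primitive starting at \<open>a\<close> vanishes to the left of the support of
  \<open>\<psi>\<close>; to the right of it, it equals the full integral, which is 0.\<close>

lemma test_function_antiderivative:
  assumes \<psi>: "test_function a b \<psi>" and ab: "a < b" and int: "integral {a..b} \<psi> = 0"
  obtains \<phi> where "test_function a b \<phi>" "deriv \<phi> = \<psi>"
proof -
  obtain c d where cd: "a < c" "d < b" "\<And>x. x \<notin> {c..d} \<Longrightarrow> \<psi> x = 0"
    using \<psi> by (auto simp: test_function_altdef)
  have cont: "continuous_on S \<psi>" for S
    using \<psi> smooth_continuous_on test_function_smooth by blast
  define \<phi> where "\<phi> x = integral {a..x} \<psi>" for x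
  have left: "\<phi> x = 0" if "x < c" for x
    unfolding \<phi>_def using that cd by (intro integral_unique has_integral_is_0) auto
  have right: "\<phi> x = 0" if "d < x" "a \<le> x" for x
  proof -
    have zero: "integral {u..v} \<psi> = 0" if "d < u" for u v
      using that cd by (intro integral_unique has_integral_is_0) auto
    show ?thesis
    proof (cases "x \<le> b")
      case True
      have "integral {a..x} \<psi> + integral {x..b} \<psi> = integral {a..b} \<psi>"
        using that True cont by (intro Henstock_Kurzweil_Integration.integral_combine integrable_continuous_real) auto
      then show ?thesis using zero[of x b] that int by (simp add: \<phi>_def)
    next
      case False
      have "integral {a..b} \<psi> + integral {b..x} \<psi> = integral {a..x} \<psi>"
        using False ab cont by (intro Henstock_Kurzweil_Integration.integral_combine integrable_continuous_real) auto
      then show ?thesis using zero[of b x] cd int by (simp add: \<phi>_def)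
    qed
  qed
  have D: "(\<phi> has_real_derivative \<psi> x) (at x)" for x
  proof (cases "x < c")
    case True
    have "((\<lambda>_. 0) has_real_derivative 0) (at x)" by simp
    then have "(\<phi> has_real_derivative 0) (at x)"
      by (rule has_field_derivative_transform_within_open[where S="{..<c}"]) (use True left in auto)
    then show ?thesis using True cd by simp
  next
    case False
    then have x: "a < x" using cd by simp
    \<comment> \<open>Extending the interval to \<open>x + 1\<close> makes \<open>x\<close> an
      interior point, so the one-sided derivative is two-sided.\<close>
    have "(\<phi> has_real_derivative \<psi> x) (at x within {a..x + 1})"
      unfolding \<phi>_def by (rule integral_has_real_derivative) (use cont x in auto)
    then show ?thesis using x by (simp add: at_within_Icc_at)
  qed
  then have deriv: "deriv \<phi> = \<psi>" using DERIV_imp_deriv by blast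
  have "smooth \<phi>"
  proof (rule smooth_coinduct[where Q="\<lambda>g. g = \<phi> \<or> smooth g"])
    fix g assume "g = \<phi> \<or> smooth g"
    then show "(\<forall>x. g differentiable (at x)) \<and> (deriv g = \<phi> \<or> smooth (deriv g))"
      using D deriv \<psi> smooth_deriv test_function_smooth smooth_has_real_derivative real_differentiable_def
      by metis
  qed simp
  moreover have "\<phi> x = 0" if "x \<notin> {c..d}" for x
    using that left right cd by (cases "x < c") auto
  ultimately have "test_function a b \<phi>"
    using cd unfolding test_function_altdef by blast
  then show thesis using deriv by (rule that)
qed

lemma test_function_integral_by_parts:
  fixes g :: "real \<Rightarrow> 'a::banach"
  assumes ab: "a < b" and \<phi>: "test_function a b \<phi>"
    and g: "\<And>t. t \<in> {a..b} \<Longrightarrow> (g has_vector_derivative g' t) (at t within {a..b})"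
    and g': "continuous_on {a..b} g'"
  shows "integral {a..b} (\<lambda>t. deriv \<phi> t *\<^sub>R g t) = - integral {a..b} (\<lambda>t. \<phi> t *\<^sub>R g' t)"
proof -
  have cont: "continuous_on {a..b} \<phi>"
    using \<phi> smooth_continuous_on test_function_smooth by blast
  have "((\<lambda>t. \<phi> t *\<^sub>R g' t) has_integral integral {a..b} (\<lambda>t. \<phi> t *\<^sub>R g' t)) {a..b}"
    by (intro integrable_integral integrable_continuous_real continuous_intros cont g')
  then have "((\<lambda>t. deriv \<phi> t *\<^sub>R g t) has_integral - integral {a..b} (\<lambda>t. \<phi> t *\<^sub>R g' t)) {a..b}"
  proof (intro integration_by_parts_interior[OF bounded_bilinear_scaleR, of a b \<phi> g])
    show "continuous_on {a..b} g"
      using g by (rule continuous_on_vector_derivative)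
    show "(\<phi> has_vector_derivative deriv \<phi> t) (at t)" for t
      using smooth_has_real_derivative[OF test_function_smooth[OF \<phi>]]
      by (simp add: has_real_derivative_iff_has_vector_derivative)
    show "(g has_vector_derivative g' t) (at t)" if "t \<in> {a<..<b}" for t
      using g[of t] that by (simp add: at_within_Icc_at)
  qed (use ab cont test_function_eq_0[OF \<phi>] in auto)
  then show ?thesis by (rule integral_unique)
qed

text \<open>Each of \<open>n\<close> integrations by parts moves one derivative onto the monomial,
  lowers its degree by one and changes the sign. This isolates the coefficient of degree
  \<open>n\<close> in the du Bois-Reymond argument.\<close>

lemma test_function_integral_monomial:
  fixes x :: "'a::banach"
  assumes ab: "a < b" and \<phi>: "test_function a b \<phi>"
  shows "integral {a..b} (\<lambda>t. (deriv ^^ n) \<phi> t *\<^sub>R ((t - a) ^ n / fact n) *\<^sub>R x)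
    = (-1) ^ n *\<^sub>R integral {a..b} \<phi> *\<^sub>R x"
proof (induction n)
  case 0
  have "\<phi> integrable_on {a..b}"
    using \<phi> smooth_continuous_on test_function_smooth integrable_continuous_real by blast
  then show ?case
    by (simp add: integral_unique[OF has_integral_scaleR_left[OF integrable_integral]])
next
  case (Suc n)
  have D: "((\<lambda>t. ((t - a) ^ Suc n / fact (Suc n)) *\<^sub>R x) has_vector_derivative ((t - a) ^ n / fact n) *\<^sub>R x) (at t within S)" for t S
  proof -
    have "((\<lambda>t. (t - a) ^ Suc n) has_real_derivative real (Suc n) * (t - a) ^ n) (at t within S)"
      by (auto intro!: derivative_eq_intros) (cases n; simp add: algebra_simps)
    from DERIV_cdivide[OF this, of "fact (Suc n)"]
    have "((\<lambda>t. (t - a) ^ Suc n / fact (Suc n)) has_vector_derivative (t - a) ^ n / fact n) (at t within S)"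
      by (simp add: has_real_derivative_iff_has_vector_derivative del: of_nat_Suc)
    then show ?thesis
      by (rule bounded_linear.has_vector_derivative[OF bounded_linear_scaleR_left])
  qed
  have "integral {a..b} (\<lambda>t. deriv ((deriv ^^ n) \<phi>) t *\<^sub>R ((t - a) ^ Suc n / fact (Suc n)) *\<^sub>R x)
    = - integral {a..b} (\<lambda>t. (deriv ^^ n) \<phi> t *\<^sub>R ((t - a) ^ n / fact n) *\<^sub>R x)"
    by (intro test_function_integral_by_parts[OF ab test_function_higher_deriv[OF \<phi>]] D)
      (auto intro!: continuous_intros)
  then show ?case using Suc by simp
qed

text \<open>For \<open>n = 0\<close> a narrow bump detects a nonzero value. In the step, a test
  function minus its integral times a fixed unit-mass \<open>\<theta>\<close> is the derivative of a
  test function; this reduces the claim to \<open>G\<close> minus one monomial of degree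
  \<open>n\<close>.\<close>

lemma du_Bois_Reymond:
  fixes G :: "real \<Rightarrow> 'a::banach"
  assumes ab: "a < b" and G: "continuous_on {a..b} G"
    and zero: "\<And>\<phi>. test_function a b \<phi> \<Longrightarrow> integral {a..b} (\<lambda>t. (deriv ^^ n) \<phi> t *\<^sub>R G t) = 0"
  shows "\<exists>c. \<forall>t\<in>{a..b}. G t = (\<Sum>j<n. ((t - a) ^ j / fact j) *\<^sub>R c j)"
  using G zero
proof (induction n arbitrary: G)
  case (0 G)
  have interior: "G t = 0" if t: "t \<in> {a<..<b}" for t
  proof (rule ccontr)
    assume "G t \<noteq> 0"
    then have "norm (G t) / 2 > 0" by simp
    moreover have "isCont G t"
      using 0(1) t continuous_on_interior[of "{a..b}" G t] by simp
    ultimately obtain r where r: "r > 0" "\<And>s. dist s t < r \<Longrightarrow> dist (G s) (G t) < norm (G t) / 2"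
      unfolding continuous_at_eps_delta by blast
    \<comment> \<open>Small enough for \<open>G\<close> to stay within \<open>norm (G t) / 2\<close>
      of \<open>G t\<close> on the support of the bump, and for that support to lie inside the open
      interval.\<close>
    define \<delta> where "\<delta> = min (r/2) (min ((t - a)/2) ((b - t)/2))"
    have \<delta>: "\<delta> > 0" "\<delta> < r" "a < t - \<delta>" "t + \<delta> < b"
      using t r by (auto simp: \<delta>_def min_def field_simps)
    obtain \<theta> where \<theta>: "smooth \<theta>" "\<And>x. \<theta> x \<ge> 0" "\<And>x. x \<notin> {t-\<delta>..t+\<delta>} \<Longrightarrow> \<theta> x = 0"
      "\<And>x. t - \<delta> < x \<Longrightarrow> x < t + \<delta> \<Longrightarrow> \<theta> x > 0"
      using ex_smooth_bump[of "t - \<delta>" "t + \<delta>"] \<delta> by auto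
    have test: "test_function a b \<theta>"
      unfolding test_function_altdef using \<theta> \<delta> by blast
    have cont: "continuous_on {a..b} \<theta>" by (rule smooth_continuous_on) fact
    have pos: "integral {a..b} \<theta> > 0"
    proof -
      have "integral {a..b} \<theta> \<noteq> 0"
      proof
        assume "integral {a..b} \<theta> = 0"
        then have "\<theta> t = 0"
          using integral_eq_0_iff[of a b \<theta>] cont ab \<theta>(2) t by auto
        then show False using \<theta>(4)[of t] \<delta> by simp
      qed
      moreover have "integral {a..b} \<theta> \<ge> 0"
        using \<theta>(2) cont by (intro Henstock_Kurzweil_Integration.integral_nonneg integrable_continuous_real) auto
      ultimately show ?thesis by simp
    qed
    \<comment> \<open>As \<open>\<theta> *\<^sub>R G\<close> integrates to 0, the left side is the
      mass of \<open>\<theta>\<close> times \<open>norm (G t)\<close>, twice the right side; this is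
      impossible.\<close>
    have "norm (integral {a..b} (\<lambda>s. \<theta> s *\<^sub>R (G s - G t))) \<le> integral {a..b} (\<lambda>s. \<theta> s * (norm (G t) / 2))"
    proof (rule Henstock_Kurzweil_Integration.integral_norm_bound_integral)
      fix s assume "s \<in> {a..b}"
      show "norm (\<theta> s *\<^sub>R (G s - G t)) \<le> \<theta> s * (norm (G t) / 2)"
      proof (cases "s \<in> {t-\<delta>..t+\<delta>}")
        case True
        then have "dist s t < r" using \<delta> by (auto simp: dist_real_def)
        then have "norm (G s - G t) \<le> norm (G t) / 2" using r(2)[of s] by (simp add: dist_norm)
        from mult_left_mono[OF this \<theta>(2)[of s]] show ?thesis using \<theta>(2)[of s] by simp
      qed (use \<theta>(3) in auto)
    qed (intro integrable_continuous_real continuous_intros cont 0(1))+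
    also have "integral {a..b} (\<lambda>s. \<theta> s *\<^sub>R (G s - G t)) =
        integral {a..b} (\<lambda>s. \<theta> s *\<^sub>R G s) - integral {a..b} (\<lambda>s. \<theta> s *\<^sub>R G t)"
      unfolding scaleR_diff_right
      by (intro Henstock_Kurzweil_Integration.integral_diff integrable_continuous_real continuous_intros cont 0(1))
    also have "\<dots> = - (integral {a..b} \<theta> *\<^sub>R G t)"
      using 0(2)[OF test] cont
      by (simp add: integral_unique[OF has_integral_scaleR_left[OF integrable_integral]] integrable_continuous_real)
    also have "integral {a..b} (\<lambda>s. \<theta> s * (norm (G t) / 2)) = integral {a..b} \<theta> * (norm (G t) / 2)"
      by simp
    finally show False using pos \<open>G t \<noteq> 0\<close> by simp
  qed
  have "G t = 0" if "t \<in> {a..b}" for t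
    using continuous_constant_on_closure[of "{a<..<b}" G 0 t] 0(1) interior ab that by simp
  then show ?case by simp
next
  case (Suc n)
  obtain \<theta> where \<theta>: "test_function a b \<theta>" "integral {a..b} \<theta> = 1"
  proof -
    define c d where "c = a + (b - a) / 4" and "d = b - (b - a) / 4"
    have cd: "a < c" "c < d" "d < b" using ab by (auto simp: c_def d_def field_simps)
    obtain \<theta> where \<theta>: "smooth \<theta>" "\<And>x. \<theta> x \<ge> 0" "\<And>x. x \<notin> {c..d} \<Longrightarrow> \<theta> x = 0"
      "\<And>x. c < x \<Longrightarrow> x < d \<Longrightarrow> \<theta> x > 0"
      using ex_smooth_bump[OF cd(2)] by blast
    have test: "test_function a b \<theta>"
      unfolding test_function_altdef using \<theta> cd by blast
    have cont: "continuous_on {a..b} \<theta>" by (rule smooth_continuous_on) fact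
    have nz: "integral {a..b} \<theta> \<noteq> 0"
    proof
      assume "integral {a..b} \<theta> = 0"
      then have "\<theta> ((c + d) / 2) = 0"
        using integral_eq_0_iff[of a b \<theta>] cont ab \<theta>(2) cd by auto
      then show False using \<theta>(4)[of "(c + d) / 2"] cd by simp
    qed
    \<comment> \<open>This is \<open>\<theta>\<close> divided by its integral, written in the shape
      of \<open>test_function_diff_mult\<close>.\<close>
    have "test_function a b (\<lambda>x. 0 - (- 1 / integral {a..b} \<theta>) * \<theta> x)"
      by (intro test_function_diff_mult test test_function_0)
    then show thesis
      using nz by (intro that[of "\<lambda>x. 0 - (- 1 / integral {a..b} \<theta>) * \<theta> x"]) auto
  qed
  \<comment> \<open>Forced by testing with \<open>(deriv ^^ n) \<theta>\<close>: against the
    monomial of degree \<open>n\<close> with coefficient \<open>c\<close> this gives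
    \<open>(-1) ^ n *\<^sub>R c\<close>, since \<open>\<theta>\<close> has unit mass.\<close>
  define c where "c = (-1) ^ n *\<^sub>R integral {a..b} (\<lambda>t. (deriv ^^ n) \<theta> t *\<^sub>R G t)"
  define H where "H t = G t - ((t - a) ^ n / fact n) *\<^sub>R c" for t
  have "\<exists>c. \<forall>t\<in>{a..b}. H t = (\<Sum>j<n. ((t - a) ^ j / fact j) *\<^sub>R c j)"
  proof (rule Suc.IH)
    show "continuous_on {a..b} H"
      unfolding H_def by (intro continuous_intros Suc.prems) auto
    fix \<psi> assume \<psi>: "test_function a b \<psi>"
    let ?I = "integral {a..b} \<psi>"
    have cont: "continuous_on {a..b} \<psi>" "continuous_on {a..b} \<theta>"
      "continuous_on {a..b} ((deriv ^^ n) \<psi>)" "continuous_on {a..b} ((deriv ^^ n) \<theta>)"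
      by (intro smooth_continuous_on smooth_higher_deriv test_function_smooth[OF \<psi>] test_function_smooth[OF \<theta>(1)])+
    have "integral {a..b} (\<lambda>x. \<psi> x - ?I * \<theta> x) = ?I - integral {a..b} (\<lambda>x. ?I * \<theta> x)"
      by (intro Henstock_Kurzweil_Integration.integral_diff integrable_continuous_real continuous_intros cont)
    then have "integral {a..b} (\<lambda>x. \<psi> x - ?I * \<theta> x) = 0"
      using \<theta>(2) by simp
    from test_function_antiderivative[OF test_function_diff_mult[OF \<psi> \<theta>(1)] ab this]
    obtain \<phi> where \<phi>: "test_function a b \<phi>" "deriv \<phi> = (\<lambda>x. \<psi> x - ?I * \<theta> x)" .
    have "(deriv ^^ Suc n) \<phi> = (\<lambda>t. (deriv ^^ n) \<psi> t - ?I * (deriv ^^ n) \<theta> t)"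
      unfolding funpow_Suc_right comp_apply \<phi>(2)
      by (rule higher_deriv_diff_mult[OF test_function_smooth[OF \<psi>] test_function_smooth[OF \<theta>(1)]])
    then have "0 = integral {a..b} (\<lambda>t. ((deriv ^^ n) \<psi> t - ?I * (deriv ^^ n) \<theta> t) *\<^sub>R G t)"
      using Suc.prems(2)[OF \<phi>(1)] by simp
    also have "\<dots> = integral {a..b} (\<lambda>t. (deriv ^^ n) \<psi> t *\<^sub>R G t) -
        integral {a..b} (\<lambda>t. ?I *\<^sub>R ((deriv ^^ n) \<theta> t *\<^sub>R G t))"
      unfolding scaleR_diff_left scaleR_scaleR[symmetric]
      by (intro Henstock_Kurzweil_Integration.integral_diff integrable_continuous_real continuous_intros cont Suc.prems(1))
    also have "integral {a..b} (\<lambda>t. ?I *\<^sub>R ((deriv ^^ n) \<theta> t *\<^sub>R G t)) = (-1) ^ n *\<^sub>R ?I *\<^sub>R c"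
    proof -
      have "(-1) ^ n *\<^sub>R ?I *\<^sub>R c
          = ((-1) ^ n * (-1) ^ n) *\<^sub>R ?I *\<^sub>R integral {a..b} (\<lambda>t. (deriv ^^ n) \<theta> t *\<^sub>R G t)"
        unfolding c_def scaleR_scaleR by (simp only: mult_ac)
      also have "(-1) ^ n * (-1) ^ n = (1::real)"
        by (simp flip: power_mult_distrib)
      finally show ?thesis
        by (simp only: scaleR_one integral_cmul)
    qed
    also have "\<dots> = integral {a..b} (\<lambda>t. (deriv ^^ n) \<psi> t *\<^sub>R ((t - a) ^ n / fact n) *\<^sub>R c)"
      by (rule test_function_integral_monomial[OF ab \<psi>, symmetric])
    also have "integral {a..b} (\<lambda>t. (deriv ^^ n) \<psi> t *\<^sub>R G t) - \<dots> = integral {a..b} (\<lambda>t. (deriv ^^ n) \<psi> t *\<^sub>R H t)"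
      unfolding H_def scaleR_diff_right
      by (intro Henstock_Kurzweil_Integration.integral_diff[symmetric] integrable_continuous_real continuous_intros cont Suc.prems(1)) auto
    finally show "integral {a..b} (\<lambda>t. (deriv ^^ n) \<psi> t *\<^sub>R H t) = 0" by simp
  qed
  then obtain d where d: "\<forall>t\<in>{a..b}. H t = (\<Sum>j<n. ((t - a) ^ j / fact j) *\<^sub>R d j)" by blast
  have "G t = (\<Sum>j<Suc n. ((t - a) ^ j / fact j) *\<^sub>R (d(n := c)) j)" if "t \<in> {a..b}" for t
  proof -
    have "G t = H t + ((t - a) ^ n / fact n) *\<^sub>R c" by (simp add: H_def)
    also have "H t = (\<Sum>j<n. ((t - a) ^ j / fact j) *\<^sub>R (d(n := c)) j)"
      using d that by simp
    finally show ?thesis by simp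
  qed
  then show ?case by blast
qed

section \<open>Riemann--Liouville integrals\<close>

lemma Gamma_pos_nonzero: "(x::real) > 0 \<Longrightarrow> Gamma x \<noteq> 0"
  using Gamma_real_pos[of x] by linarith

lemma continuous_on_Icc_le:
  "continuous_on {a..b} f \<Longrightarrow> (t::real) \<le> b \<Longrightarrow> continuous_on {a..t} f"
  by (rule continuous_on_subset) auto

text \<open>The case distinction is needed because \<open>0 powr 0 = 0\<close>.\<close>
definition frac_monom :: "real \<Rightarrow> real \<Rightarrow> real \<Rightarrow> real" where
  "frac_monom a \<gamma> t = (if \<gamma> = 0 then 1 else (t - a) powr \<gamma>) / Gamma (\<gamma> + 1)"

lemma frac_monom_0 [simp]: "frac_monom a 0 t = 1"
  by (simp add: frac_monom_def)

lemma frac_monom_left: "\<gamma> \<noteq> 0 \<Longrightarrow> frac_monom a \<gamma> a = 0"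
  by (simp add: frac_monom_def)

lemma frac_monom_of_nat: "a \<le> t \<Longrightarrow> frac_monom a (real j) t = (t - a) ^ j / fact j"
  using Gamma_fact[of j, where 'a=real]
  by (cases "t = a") (auto simp: frac_monom_def powr_realpow add.commute)

lemma frac_monom_nonneg: "\<gamma> \<ge> 0 \<Longrightarrow> frac_monom a \<gamma> t \<ge> 0"
  by (auto simp: frac_monom_def intro!: divide_nonneg_pos Gamma_real_pos)

lemma frac_monom_mono: "\<gamma> \<ge> 0 \<Longrightarrow> a \<le> s \<Longrightarrow> s \<le> t \<Longrightarrow> frac_monom a \<gamma> s \<le> frac_monom a \<gamma> t"
  by (auto simp: frac_monom_def intro!: divide_right_mono powr_mono2 less_imp_le[OF Gamma_real_pos])

lemma continuous_on_frac_monom: "\<gamma> \<ge> 0 \<Longrightarrow> continuous_on {a..b} (frac_monom a \<gamma>)"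
proof (cases "\<gamma> = 0")
  case True
  then show ?thesis by (simp add: frac_monom_def[abs_def])
next
  case False
  assume "\<gamma> \<ge> 0"
  with False have pos: "\<gamma> > 0" by simp
  have "continuous_on {a..b} (\<lambda>t. (t - a) powr \<gamma>)"
    by (rule continuous_on_powr') (use pos in \<open>auto intro!: continuous_intros\<close>)
  then have "continuous_on {a..b} (\<lambda>t. (t - a) powr \<gamma> / Gamma (\<gamma> + 1))"
    by (rule continuous_on_divide) (use pos in \<open>auto simp: Gamma_pos_nonzero\<close>)
  then show ?thesis
    using pos by (simp add: frac_monom_def[abs_def])
qed

text \<open>The substitution \<open>u = (s - a) / l\<close> with \<open>l = t - a\<close> turns this
  into the Beta integral over the unit interval; the powers of \<open>l\<close> collect to
  \<open>\<alpha> + \<gamma>\<close>.\<close>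

lemma has_integral_kernel_powr:
  fixes a t :: real
  assumes "\<alpha> > 0" "\<gamma> \<ge> 0" "a \<le> t"
  shows "((\<lambda>s. (t - s) powr (\<alpha> - 1) * (s - a) powr \<gamma>) has_integral
    Beta (\<gamma> + 1) \<alpha> * (t - a) powr (\<alpha> + \<gamma>)) {a..t}"
proof (cases "a = t")
  case True
  then show ?thesis by (simp add: has_integral_refl)
next
  case False
  define l where "l = t - a"
  have l: "l > 0" and t: "t = a + l" using False assms by (simp_all add: l_def)
  have "((\<lambda>u. u powr \<gamma> * (1 - u) powr (\<alpha> - 1)) has_integral Beta (\<gamma> + 1) \<alpha>) (cbox 0 1)"
    using has_integral_Beta_real[of "\<gamma> + 1" \<alpha>] assms by simp
  note aff = has_integral_affinity'[OF this, of "1/l" "- a/l"]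
  have "((\<lambda>s. ((s - a)/l) powr \<gamma> * ((t - s)/l) powr (\<alpha> - 1)) has_integral Beta (\<gamma> + 1) \<alpha> * l) {a..t}"
  proof -
    have "((\<lambda>s. ((1/l) * s + - a/l) powr \<gamma> * (1 - ((1/l) * s + - a/l)) powr (\<alpha> - 1)) has_integral
        Beta (\<gamma> + 1) \<alpha> * l) {(0 - - a/l) * l..(1 - - a/l) * l}"
      using aff l by (simp add: mult.commute)
    moreover have "(1/l) * s + - a/l = (s - a)/l" "1 - (s - a)/l = (t - s)/l" for s
      using l unfolding t by (simp_all add: field_simps)
    moreover have "(0 - - a/l) * l = a" "(1 - - a/l) * l = t"
      using l unfolding t by (simp_all add: field_simps)
    ultimately show ?thesis by (simp only:)
  qed
  from has_integral_mult_right[OF this, of "l powr (\<gamma> + (\<alpha> - 1))"]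
  have *: "((\<lambda>s. l powr (\<gamma> + (\<alpha> - 1)) * (((s - a)/l) powr \<gamma> * ((t - s)/l) powr (\<alpha> - 1))) has_integral
      l powr (\<gamma> + (\<alpha> - 1)) * (Beta (\<gamma> + 1) \<alpha> * l)) {a..t}" .
  show ?thesis
  proof (rule has_integral_eq_rhs[OF has_integral_eq[OF _ *]])
    fix s assume "s \<in> {a..t}"
    then show "l powr (\<gamma> + (\<alpha> - 1)) * (((s - a)/l) powr \<gamma> * ((t - s)/l) powr (\<alpha> - 1)) =
        (t - s) powr (\<alpha> - 1) * (s - a) powr \<gamma>"
      using l by (simp add: powr_divide powr_add)
  next
    have "l powr (\<gamma> + (\<alpha> - 1)) * l = l powr (\<alpha> + \<gamma>)"
      using l by (simp add: powr_add powr_diff)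
    then show "Beta (\<gamma> + 1) \<alpha> * (t - a) powr (\<alpha> + \<gamma>) = l powr (\<gamma> + (\<alpha> - 1)) * (Beta (\<gamma> + 1) \<alpha> * l)"
      by (simp add: l_def[symmetric] mult_ac)
  qed
qed

lemma has_integral_kernel_frac_monom:
  fixes a t :: real
  assumes "\<alpha> > 0" "\<gamma> \<ge> 0" "a \<le> t"
  shows "((\<lambda>s. (t - s) powr (\<alpha> - 1) * frac_monom a \<gamma> s) has_integral
    Gamma \<alpha> * frac_monom a (\<gamma> + \<alpha>) t) {a..t}"
proof -
  have "((\<lambda>s. (t - s) powr (\<alpha> - 1) * (s - a) powr \<gamma> / Gamma (\<gamma> + 1)) has_integral
      Beta (\<gamma> + 1) \<alpha> * (t - a) powr (\<alpha> + \<gamma>) / Gamma (\<gamma> + 1)) {a..t}"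
    by (intro has_integral_divide has_integral_kernel_powr assms)
  moreover have "Beta (\<gamma> + 1) \<alpha> * (t - a) powr (\<alpha> + \<gamma>) / Gamma (\<gamma> + 1) = Gamma \<alpha> * frac_monom a (\<gamma> + \<alpha>) t"
    using assms by (simp add: Beta_def frac_monom_def add_ac Gamma_pos_nonzero)
  ultimately have *: "((\<lambda>s. (t - s) powr (\<alpha> - 1) * (s - a) powr \<gamma> / Gamma (\<gamma> + 1)) has_integral
      Gamma \<alpha> * frac_monom a (\<gamma> + \<alpha>) t) {a..t}" by simp
  show ?thesis
    \<comment> \<open>For \<open>\<gamma> = 0\<close> the integrands differ at \<open>s = a\<close>,
      where \<open>0 powr 0 = 0\<close>; a single point is negligible.\<close>
    by (rule has_integral_spike_finite[OF _ _ *, of "{a}"]) (auto simp: frac_monom_def)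
qed

text \<open>A nonnegative function with a gauge integral is absolutely integrable. This makes the
  kernel an admissible weight for the Bochner integral of a continuous function.\<close>

lemma integrable_kernel:
  fixes a t :: real
  assumes "\<alpha> > 0" "a \<le> t"
  shows "integrable (lebesgue_on {a..t}) (\<lambda>s. (t - s) powr (\<alpha> - 1))"
proof (rule absolutely_integrable_imp_integrable)
  show "(\<lambda>s. (t - s) powr (\<alpha> - 1)) absolutely_integrable_on {a..t}"
    using has_integral_kernel_frac_monom[OF assms(1) order_refl assms(2)]
    by (intro nonnegative_absolutely_integrable_1) auto
qed simp

lemma
  fixes f :: "real \<Rightarrow> 'a::banach"
  assumes \<alpha>: "\<alpha> > 0" and t: "a \<le> t" and f: "continuous_on {a..t} f"
  shows kernel_integrable_on: "(\<lambda>s. (t - s) powr (\<alpha> - 1) *\<^sub>R f s) integrable_on {a..t}"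
    and RL_integral_eq: "RL_integral \<alpha> a f t =
      (1 / Gamma \<alpha>) *\<^sub>R integral {a..t} (\<lambda>s. (t - s) powr (\<alpha> - 1) *\<^sub>R f s)"
proof -
  have *: "((\<lambda>s. (t - s) powr (\<alpha> - 1) *\<^sub>R f s) has_integral
      bochner_int (lebesgue_on {a..t}) (\<lambda>s. (t - s) powr (\<alpha> - 1) *\<^sub>R f s)) {a..t}"
    by (rule scaleR_continuous_has_integral[OF _ order_refl integrable_kernel[OF \<alpha> t] f]) simp
  show "(\<lambda>s. (t - s) powr (\<alpha> - 1) *\<^sub>R f s) integrable_on {a..t}"
    using * by blast
  show "RL_integral \<alpha> a f t =
      (1 / Gamma \<alpha>) *\<^sub>R integral {a..t} (\<lambda>s. (t - s) powr (\<alpha> - 1) *\<^sub>R f s)"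
    using \<alpha> by (simp add: RL_integral_def integral_unique[OF *])
qed

section \<open>Linearity, bounds and uniform limits of Riemann-Liouville integrals\<close>

lemma RL_integral_0 [simp]: "RL_integral 0 a f = f"
  by (simp add: RL_integral_def)

lemma RL_integral_cong:
  fixes f :: "real \<Rightarrow> 'a::banach"
  assumes "\<alpha> \<ge> 0" "a \<le> t" "continuous_on {a..t} f" "\<And>s. s \<in> {a..t} \<Longrightarrow> f s = g s"
  shows "RL_integral \<alpha> a f t = RL_integral \<alpha> a g t"
proof (cases "\<alpha> = 0")
  case False
  have "continuous_on {a..t} g"
    using assms(3,4) continuous_on_cong by blast
  moreover have "integral {a..t} (\<lambda>s. (t - s) powr (\<alpha> - 1) *\<^sub>R f s) =
      integral {a..t} (\<lambda>s. (t - s) powr (\<alpha> - 1) *\<^sub>R g s)"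
    using assms by (intro Henstock_Kurzweil_Integration.integral_cong) simp
  ultimately show ?thesis
    using assms False by (simp add: RL_integral_eq)
qed (use assms in simp)

lemma RL_integral_add:
  fixes f :: "real \<Rightarrow> 'a::banach"
  assumes "\<alpha> \<ge> 0" "a \<le> t" "continuous_on {a..t} f" "continuous_on {a..t} g"
  shows "RL_integral \<alpha> a (\<lambda>s. f s + g s) t = RL_integral \<alpha> a f t + RL_integral \<alpha> a g t"
proof (cases "\<alpha> = 0")
  case False
  then show ?thesis
    using assms
    by (simp add: RL_integral_eq continuous_on_add scaleR_add_right kernel_integrable_on
        Henstock_Kurzweil_Integration.integral_add)
qed simp

lemma RL_integral_scaleR:
  fixes f :: "real \<Rightarrow> 'a::banach"
  assumes "\<alpha> \<ge> 0" "a \<le> t" "continuous_on {a..t} f"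
  shows "RL_integral \<alpha> a (\<lambda>s. c *\<^sub>R f s) t = c *\<^sub>R RL_integral \<alpha> a f t"
proof (cases "\<alpha> = 0")
  case False
  have "(\<lambda>s. (t - s) powr (\<alpha> - 1) *\<^sub>R c *\<^sub>R f s) = (\<lambda>s. c *\<^sub>R (t - s) powr (\<alpha> - 1) *\<^sub>R f s)"
    by (simp add: mult.commute)
  with False show ?thesis
    using assms by (simp add: RL_integral_eq continuous_on_scaleR scaleR_left_commute del: scaleR_scaleR)
qed simp

lemma RL_integral_diff:
  fixes f :: "real \<Rightarrow> 'a::banach"
  assumes "\<alpha> \<ge> 0" "a \<le> t" "continuous_on {a..t} f" "continuous_on {a..t} g"
  shows "RL_integral \<alpha> a (\<lambda>s. f s - g s) t = RL_integral \<alpha> a f t - RL_integral \<alpha> a g t"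
  using RL_integral_add[of \<alpha> a t f "\<lambda>s. (-1) *\<^sub>R g s"] RL_integral_scaleR[of \<alpha> a t g "-1"] assms
  by (simp add: continuous_on_minus)

lemma RL_integral_zero [simp]: "a \<le> t \<Longrightarrow> \<alpha> \<ge> 0 \<Longrightarrow> RL_integral \<alpha> a (\<lambda>_. 0 :: 'a::banach) t = 0"
  using RL_integral_scaleR[of \<alpha> a t "\<lambda>_. 0 :: 'a" 0] by simp

lemma RL_integral_sum:
  fixes f :: "'i \<Rightarrow> real \<Rightarrow> 'a::banach"
  assumes "\<alpha> \<ge> 0" "a \<le> t" "\<And>i. i \<in> I \<Longrightarrow> continuous_on {a..t} (f i)"
  shows "RL_integral \<alpha> a (\<lambda>s. \<Sum>i\<in>I. f i s) t = (\<Sum>i\<in>I. RL_integral \<alpha> a (f i) t)"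
  using assms(3)
proof (induction I rule: infinite_finite_induct)
  case (insert i I)
  have "RL_integral \<alpha> a (\<lambda>s. f i s + (\<Sum>i\<in>I. f i s)) t = RL_integral \<alpha> a (f i) t + RL_integral \<alpha> a (\<lambda>s. \<Sum>i\<in>I. f i s) t"
    using assms insert.prems by (intro RL_integral_add continuous_on_sum) auto
  with insert show ?case by simp
qed (use assms in auto)

lemma RL_integral_frac_monom:
  fixes x :: "'a::banach"
  assumes "\<alpha> \<ge> 0" "\<gamma> \<ge> 0" "a \<le> t"
  shows "RL_integral \<alpha> a (\<lambda>s. frac_monom a \<gamma> s *\<^sub>R x) t = frac_monom a (\<gamma> + \<alpha>) t *\<^sub>R x"
proof (cases "\<alpha> = 0")
  case False
  then have \<alpha>: "\<alpha> > 0" "Gamma \<alpha> > 0" using assms by (auto intro: Gamma_real_pos)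
  have "continuous_on {a..t} (\<lambda>s. frac_monom a \<gamma> s *\<^sub>R x)"
    by (intro continuous_intros continuous_on_frac_monom assms)
  then show ?thesis
    using \<alpha> assms has_integral_scaleR_left[OF has_integral_kernel_frac_monom[OF \<alpha>(1) assms(2,3)], of x]
    by (simp add: RL_integral_eq integral_unique Gamma_pos_nonzero)
qed simp

text \<open>The kernel is nonnegative and its total mass, divided by \<open>Gamma \<alpha>\<close>,
  is \<open>frac_monom a \<alpha> t\<close>.\<close>

lemma norm_RL_integral_le:
  fixes f :: "real \<Rightarrow> 'a::banach"
  assumes "\<alpha> \<ge> 0" "a \<le> t" "continuous_on {a..t} f" "\<And>s. s \<in> {a..t} \<Longrightarrow> norm (f s) \<le> B"
  shows "norm (RL_integral \<alpha> a f t) \<le> frac_monom a \<alpha> t * B"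
proof (cases "\<alpha> = 0")
  case False
  then have \<alpha>: "\<alpha> > 0" "Gamma \<alpha> > 0" using assms by (auto intro: Gamma_real_pos)
  have k: "((\<lambda>s. (t - s) powr (\<alpha> - 1) * B) has_integral Gamma \<alpha> * frac_monom a \<alpha> t * B) {a..t}"
    using has_integral_mult_left[OF has_integral_kernel_frac_monom[OF \<alpha>(1) order_refl assms(2)], of B] by simp
  have "norm (integral {a..t} (\<lambda>s. (t - s) powr (\<alpha> - 1) *\<^sub>R f s)) \<le> integral {a..t} (\<lambda>s. (t - s) powr (\<alpha> - 1) * B)"
    using k assms \<alpha>
    by (intro Henstock_Kurzweil_Integration.integral_norm_bound_integral kernel_integrable_on)
      (auto intro: mult_left_mono)
  also have "\<dots> = Gamma \<alpha> * (frac_monom a \<alpha> t * B)"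
    using integral_unique[OF k] by simp
  finally show ?thesis
    using \<alpha> assms by (simp add: RL_integral_eq pos_divide_le_eq mult.commute)
qed (use assms in simp)

lemma RL_integral_left:
  fixes f :: "real \<Rightarrow> 'a::banach"
  assumes "\<alpha> > 0"
  shows "RL_integral \<alpha> a f a = 0"
proof -
  have "norm (RL_integral \<alpha> a f a) \<le> frac_monom a \<alpha> a * norm (f a)"
    using assms by (intro norm_RL_integral_le) auto
  then show ?thesis using assms by (simp add: frac_monom_left)
qed

lemma uniform_limit_RL_integral:
  fixes f :: "real \<Rightarrow> 'a::banach"
  assumes "\<alpha> \<ge> 0" and F: "\<And>n. continuous_on {a..b} (F n)" and f: "continuous_on {a..b} f"
    and lim: "uniform_limit {a..b} F f sequentially"
  shows "uniform_limit {a..b} (\<lambda>n. RL_integral \<alpha> a (F n)) (RL_integral \<alpha> a f) sequentially"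
proof (rule uniform_limitI)
  fix e :: real assume e: "e > 0"
  \<comment> \<open>The summand 1 makes \<open>C\<close> positive and strictly larger than the bound
    for the operator at \<open>b\<close>.\<close>
  define C where "C = frac_monom a \<alpha> b + 1"
  have C: "C > 0" using frac_monom_nonneg[OF assms(1), of a b] by (simp add: C_def)
  have "\<forall>\<^sub>F n in sequentially. \<forall>t\<in>{a..b}. dist (F n t) (f t) < e / C"
    using lim e C by (intro uniform_limitD) auto
  then show "\<forall>\<^sub>F n in sequentially. \<forall>t\<in>{a..b}. dist (RL_integral \<alpha> a (F n) t) (RL_integral \<alpha> a f t) < e"
  proof eventually_elim
    case (elim n)
    show ?case
    proof
      fix t assume t: "t \<in> {a..b}"
      have cont: "continuous_on {a..t} (F n)" "continuous_on {a..t} f"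
        using F f t by (auto intro: continuous_on_Icc_le)
      have "norm (RL_integral \<alpha> a (\<lambda>s. F n s - f s) t) \<le> frac_monom a \<alpha> t * (e / C)"
        using t cont elim assms(1)
        by (intro norm_RL_integral_le continuous_on_diff) (auto simp: dist_norm less_imp_le)
      also have "\<dots> \<le> frac_monom a \<alpha> b * (e / C)"
        using t e C assms(1) by (intro mult_right_mono frac_monom_mono) auto
      also have "\<dots> < C * (e / C)"
        using e C by (intro mult_strict_right_mono) (auto simp: C_def)
      finally show "dist (RL_integral \<alpha> a (F n) t) (RL_integral \<alpha> a f t) < e"
        using C t cont assms(1) by (simp add: RL_integral_diff dist_norm)
    qed
  qed
qed

section \<open>Continuity and the semigroup law\<close>

lemma RL_integral_monomial:
  fixes x :: "'a::banach"
  assumes "\<alpha> \<ge> 0" "a \<le> t"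
  shows "RL_integral \<alpha> a (\<lambda>s. (s - a) ^ j *\<^sub>R x) t = frac_monom a (real j + \<alpha>) t *\<^sub>R fact j *\<^sub>R x"
proof -
  have "RL_integral \<alpha> a (\<lambda>s. (s - a) ^ j *\<^sub>R x) t = RL_integral \<alpha> a (\<lambda>s. frac_monom a (real j) s *\<^sub>R fact j *\<^sub>R x) t"
    using assms by (intro RL_integral_cong) (auto intro!: continuous_intros simp: frac_monom_of_nat)
  then show ?thesis using assms by (simp only: RL_integral_frac_monom of_nat_0_le_iff)
qed

text \<open>Monomials go to continuous fractional monomials, and the operator respects sums and
  uniform limits, so density of polynomials suffices.\<close>

lemma continuous_on_RL_integral:
  fixes f :: "real \<Rightarrow> 'a::banach"
  assumes ab: "a < b" and f: "continuous_on {a..b} f" and \<alpha>: "\<alpha> \<ge> 0"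
  shows "continuous_on {a..b} (RL_integral \<alpha> a f)"
  using ab f
proof (induction rule: continuous_on_Icc_induct)
  case (monomial j x)
  have "continuous_on {a..b} (\<lambda>t. frac_monom a (real j + \<alpha>) t *\<^sub>R fact j *\<^sub>R x)"
    using \<alpha> by (intro continuous_intros continuous_on_frac_monom) auto
  then show ?case
    by (rule continuous_on_eq) (use \<alpha> in \<open>simp add: RL_integral_monomial\<close>)
next
  case (add f g)
  have "continuous_on {a..b} (\<lambda>t. RL_integral \<alpha> a f t + RL_integral \<alpha> a g t)"
    by (intro continuous_intros add)
  then show ?case
  proof (rule continuous_on_eq)
    fix t assume t: "t \<in> {a..b}"
    then have "{a..t} \<subseteq> {a..b}" by auto
    then show "RL_integral \<alpha> a f t + RL_integral \<alpha> a g t = RL_integral \<alpha> a (\<lambda>t. f t + g t) t"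
      using t \<alpha> add(1,2) by (simp add: RL_integral_add continuous_on_subset)
  qed
next
  case (limit F f)
  show ?case
    by (rule uniform_limit_theorem[OF _ uniform_limit_RL_integral[OF \<alpha> limit(1,2,3)]])
      (use limit(4) in auto)
qed

text \<open>Both sides raise the order of a monomial by \<open>\<alpha> + \<beta>\<close>. Density
  extends this to all continuous functions, without exchanging the order of integration for vector
  values.\<close>

lemma RL_integral_semigroup:
  fixes f :: "real \<Rightarrow> 'a::banach"
  assumes ab: "a < b" and f: "continuous_on {a..b} f" and \<alpha>: "\<alpha> \<ge> 0" and \<beta>: "\<beta> \<ge> 0"
  shows "\<forall>t\<in>{a..b}. RL_integral \<alpha> a (RL_integral \<beta> a f) t = RL_integral (\<alpha> + \<beta>) a f t"
  using ab f
proof (induction rule: continuous_on_Icc_induct)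
  case (monomial j x)
  show ?case
  proof
    fix t assume t: "t \<in> {a..b}"
    have "RL_integral \<alpha> a (RL_integral \<beta> a (\<lambda>t. (t - a) ^ j *\<^sub>R x)) t
        = RL_integral \<alpha> a (\<lambda>t. frac_monom a (real j + \<beta>) t *\<^sub>R fact j *\<^sub>R x) t"
    proof (rule RL_integral_cong[symmetric])
      show "continuous_on {a..t} (\<lambda>t. frac_monom a (real j + \<beta>) t *\<^sub>R fact j *\<^sub>R x)"
        using \<beta> by (intro continuous_intros continuous_on_frac_monom) auto
    qed (use t \<alpha> \<beta> in \<open>auto simp: RL_integral_monomial\<close>)
    also have "\<dots> = frac_monom a (real j + \<beta> + \<alpha>) t *\<^sub>R fact j *\<^sub>R x"
      using t \<alpha> \<beta> by (intro RL_integral_frac_monom) auto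
    also have "\<dots> = RL_integral (\<alpha> + \<beta>) a (\<lambda>t. (t - a) ^ j *\<^sub>R x) t"
      using t \<alpha> \<beta> by (simp add: RL_integral_monomial add_ac)
    finally show "RL_integral \<alpha> a (RL_integral \<beta> a (\<lambda>t. (t - a) ^ j *\<^sub>R x)) t =
      RL_integral (\<alpha> + \<beta>) a (\<lambda>t. (t - a) ^ j *\<^sub>R x) t" .
  qed
next
  case (add f g)
  show ?case
  proof
    fix t assume t: "t \<in> {a..b}"
    have sub: "continuous_on {a..s} f" "continuous_on {a..s} g"
      "continuous_on {a..s} (RL_integral \<beta> a f)" "continuous_on {a..s} (RL_integral \<beta> a g)" if "s \<le> t" for s
    proof -
      have "s \<le> b" using that t by simp
      note le = continuous_on_Icc_le[OF _ this]
      show "continuous_on {a..s} f" "continuous_on {a..s} g"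
        "continuous_on {a..s} (RL_integral \<beta> a f)" "continuous_on {a..s} (RL_integral \<beta> a g)"
        by (rule le[OF add(1)] le[OF add(2)] le[OF continuous_on_RL_integral[OF ab add(1) \<beta>]]
            le[OF continuous_on_RL_integral[OF ab add(2) \<beta>]])+
    qed
    have "RL_integral \<alpha> a (RL_integral \<beta> a (\<lambda>t. f t + g t)) t
        = RL_integral \<alpha> a (\<lambda>t. RL_integral \<beta> a f t + RL_integral \<beta> a g t) t"
    proof (rule RL_integral_cong[symmetric])
      show "continuous_on {a..t} (\<lambda>t. RL_integral \<beta> a f t + RL_integral \<beta> a g t)"
        by (intro continuous_intros sub) auto
    qed (use t \<alpha> \<beta> sub in \<open>auto simp: RL_integral_add\<close>)
    then show "RL_integral \<alpha> a (RL_integral \<beta> a (\<lambda>t. f t + g t)) t = RL_integral (\<alpha> + \<beta>) a (\<lambda>t. f t + g t) t"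
      using t \<alpha> \<beta> sub[of t] add(3,4) by (simp add: RL_integral_add)
  qed
next
  case (limit F f)
  have "uniform_limit {a..b} (\<lambda>n. RL_integral \<alpha> a (RL_integral \<beta> a (F n)))
      (RL_integral \<alpha> a (RL_integral \<beta> a f)) sequentially"
    by (intro uniform_limit_RL_integral continuous_on_RL_integral ab limit \<alpha> \<beta>)
  moreover have "uniform_limit {a..b} (\<lambda>n. RL_integral (\<alpha> + \<beta>) a (F n))
      (RL_integral (\<alpha> + \<beta>) a f) sequentially"
    using \<alpha> \<beta> by (intro uniform_limit_RL_integral limit) auto
  ultimately have lims: "(\<lambda>n. RL_integral \<alpha> a (RL_integral \<beta> a (F n)) t) \<longlonglongrightarrow> RL_integral \<alpha> a (RL_integral \<beta> a f) t"
    "(\<lambda>n. RL_integral (\<alpha> + \<beta>) a (F n) t) \<longlonglongrightarrow> RL_integral (\<alpha> + \<beta>) a f t" if "t \<in> {a..b}" for t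
    using that by (auto intro: tendsto_uniform_limitI)
  show ?case
  proof
    fix t assume t: "t \<in> {a..b}"
    then have "(\<lambda>n. RL_integral \<alpha> a (RL_integral \<beta> a (F n)) t) = (\<lambda>n. RL_integral (\<alpha> + \<beta>) a (F n) t)"
      using limit(4) by simp
    with lims[OF t] show "RL_integral \<alpha> a (RL_integral \<beta> a f) t = RL_integral (\<alpha> + \<beta>) a f t"
      by (metis LIMSEQ_unique)
  qed
qed

section \<open>Integration of order one and injectivity\<close>

lemma RL_integral_1:
  fixes f :: "real \<Rightarrow> 'a::banach"
  assumes "a \<le> t" "continuous_on {a..t} f"
  shows "RL_integral 1 a f t = integral {a..t} f"
proof -
  have "integral {a..t} (\<lambda>s. (t - s) powr (1 - 1) *\<^sub>R f s) = integral {a..t} f"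
    \<comment> \<open>At \<open>s = t\<close> the kernel is \<open>0 powr 0 = 0\<close> rather than
      1.\<close>
    by (rule integral_spike[of "{t}"]) auto
  then show ?thesis using assms by (simp add: RL_integral_eq)
qed

lemma RL_integral_1_has_vector_derivative:
  fixes f :: "real \<Rightarrow> 'a::banach"
  assumes f: "continuous_on {a..b} f" and t: "t \<in> {a..b}"
  shows "(RL_integral 1 a f has_vector_derivative f t) (at t within {a..b})"
proof (rule has_vector_derivative_transform[OF t])
  show "((\<lambda>u. integral {a..u} f) has_vector_derivative f t) (at t within {a..b})"
    by (rule integral_has_vector_derivative[OF f t])
  show "RL_integral 1 a f u = integral {a..u} f" if "u \<in> {a..b}" for u
    using that f by (intro RL_integral_1) (auto intro: continuous_on_Icc_le)
qed

lemma vector_derivative_within_Icc: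
  fixes f :: "real \<Rightarrow> 'a::real_normed_vector"
  assumes "a < b" "t \<in> {a..b}" "(f has_vector_derivative f') (at t within {a..b})"
  shows "vector_derivative f (at t within {a..b}) = f'"
  using vector_derivative_within_cbox[of a b t f f'] assms by simp

text \<open>The semigroup law splits off one integration of order one, which differentiation undoes;
  repeat \<open>n\<close> times.\<close>

lemma RL_integral_nat_inject:
  fixes f :: "real \<Rightarrow> 'a::banach"
  assumes ab: "a < b" and f: "continuous_on {a..b} f"
    and zero: "\<And>t. t \<in> {a..b} \<Longrightarrow> RL_integral (real n) a f t = 0"
    and t: "t \<in> {a..b}"
  shows "f t = 0"
  using zero t
proof (induction n arbitrary: t)
  case (Suc n)
  show ?case
  proof (rule Suc.IH)
    fix s assume s: "s \<in> {a..b}"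
    let ?g = "RL_integral (real n) a f"
    have "(RL_integral 1 a ?g has_vector_derivative ?g s) (at s within {a..b})"
      by (intro RL_integral_1_has_vector_derivative continuous_on_RL_integral ab f s) simp
    moreover have "(RL_integral 1 a ?g has_vector_derivative 0) (at s within {a..b})"
    proof (rule has_vector_derivative_transform[OF s])
      show "RL_integral 1 a ?g u = 0" if "u \<in> {a..b}" for u
        using RL_integral_semigroup[OF ab f, of 1 "real n"] Suc.prems(1)[OF that] that by simp
    qed (rule has_vector_derivative_const)
    ultimately show "?g s = 0"
      using vector_derivative_within_Icc[OF ab s] by metis
  qed (rule Suc.prems)
qed simp

text \<open>Integrating the difference by the missing order \<open>n - \<alpha>\<close> brings it to
  the integer order \<open>n\<close>, where differentiation applies.\<close>

lemma RL_integral_inject: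
  fixes f g :: "real \<Rightarrow> 'a::banach"
  assumes ab: "a < b" and fg: "continuous_on {a..b} f" "continuous_on {a..b} g" and \<alpha>: "\<alpha> \<ge> 0"
    and eq: "\<And>t. t \<in> {a..b} \<Longrightarrow> RL_integral \<alpha> a f t = RL_integral \<alpha> a g t"
    and t: "t \<in> {a..b}"
  shows "f t = g t"
proof -
  define n where "n = nat \<lceil>\<alpha>\<rceil>"
  have n: "real n - \<alpha> \<ge> 0" by (simp add: n_def) linarith
  let ?h = "\<lambda>s. f s - g s"
  have h: "continuous_on {a..b} ?h" by (intro continuous_intros fg)
  have zero: "RL_integral \<alpha> a ?h s = 0" if "s \<in> {a..b}" for s
  proof -
    have "continuous_on {a..s} f" "continuous_on {a..s} g"
      using that fg by (auto intro: continuous_on_Icc_le)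
    then show ?thesis using that \<alpha> eq[OF that] by (simp add: RL_integral_diff)
  qed
  have "RL_integral (real n) a ?h s = 0" if s: "s \<in> {a..b}" for s
  proof -
    have "RL_integral (real n) a ?h s = RL_integral (real n - \<alpha>) a (RL_integral \<alpha> a ?h) s"
      using RL_integral_semigroup[OF ab h n \<alpha>] s by simp
    also have "\<dots> = RL_integral (real n - \<alpha>) a (\<lambda>_. 0) s"
    proof (rule RL_integral_cong)
      show "continuous_on {a..s} (RL_integral \<alpha> a ?h)"
        using continuous_on_RL_integral[OF ab h \<alpha>] s by (auto intro: continuous_on_Icc_le)
    qed (use s n zero in auto)
    finally show ?thesis using s n by simp
  qed
  from RL_integral_nat_inject[OF ab h this t] show ?thesis by simp
qed

section \<open>Taylor expansions, weak derivatives and Caputo derivatives\<close>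

lemma RL_integral_const:
  fixes x :: "'a::banach"
  assumes "\<alpha> \<ge> 0" "a \<le> t"
  shows "RL_integral \<alpha> a (\<lambda>_. x) t = frac_monom a \<alpha> t *\<^sub>R x"
  using RL_integral_frac_monom[of \<alpha> 0 a t x] assms by simp

text \<open>The last Taylor term is the integral of order \<open>k\<close> of the constant
  \<open>c k\<close>, so it merges with the remainder. With \<open>\<delta> = 1\<close> this drives
  inductions on the length of the expansion; a fractional \<open>\<delta>\<close> links orders
  \<open>\<beta>\<close> and \<open>k\<close>.\<close>

lemma RL_integral_taylor_Suc:
  fixes c :: "nat \<Rightarrow> 'a::banach"
  assumes ab: "a < b" and \<delta>: "\<delta> \<ge> 0" and h: "continuous_on {a..b} h" and t: "t \<in> {a..b}"
  shows "(\<Sum>j<Suc k. frac_monom a (real j) t *\<^sub>R c j) + RL_integral (real k + \<delta>) a h t =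
    (\<Sum>j<k. frac_monom a (real j) t *\<^sub>R c j) + RL_integral (real k) a (\<lambda>s. c k + RL_integral \<delta> a h s) t"
proof -
  have "continuous_on {a..t} (RL_integral \<delta> a h)"
    using continuous_on_RL_integral[OF ab h \<delta>] t by (auto intro: continuous_on_Icc_le)
  then have "RL_integral (real k) a (\<lambda>s. c k + RL_integral \<delta> a h s) t
      = RL_integral (real k) a (\<lambda>_. c k) t + RL_integral (real k) a (RL_integral \<delta> a h) t"
    using t by (intro RL_integral_add) auto
  then show ?thesis
    using t RL_integral_semigroup[OF ab h _ \<delta>, of "real k"] by (simp add: RL_integral_const)
qed

lemma Ck_space_SucD:
  fixes f :: "real \<Rightarrow> 'a::banach"
  assumes "f \<in> Ck_space (Suc k) a b"
  shows "f \<in> Ck_space k a b"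
    and "t \<in> {a..b} \<Longrightarrow>
      (nderiv {a..b} k f has_vector_derivative nderiv {a..b} (Suc k) f t) (at t within {a..b})"
proof -
  have "nderiv {a..b} k f differentiable (at t within {a..b})" if "t \<in> {a..b}" for t
    using assms that by (auto simp: Ck_space_def)
  then show "f \<in> Ck_space k a b"
    "t \<in> {a..b} \<Longrightarrow>
      (nderiv {a..b} k f has_vector_derivative nderiv {a..b} (Suc k) f t) (at t within {a..b})"
    using assms
    by (auto simp: Ck_space_def vector_derivative_works continuous_on_eq_continuous_within
        intro: differentiable_imp_continuous_within)
qed

lemma continuous_on_nderiv:
  fixes f :: "real \<Rightarrow> 'a::banach"
  assumes "f \<in> Ck_space k a b" "j \<le> k"
  shows "continuous_on {a..b} (nderiv {a..b} j f)"
  using assms(2,1)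
proof (induction rule: inc_induct)
  case base
  then show ?case by (simp add: Ck_space_def)
next
  case (step j)
  then show ?case
    by (auto simp: Ck_space_def continuous_on_eq_continuous_within intro: differentiable_imp_continuous_within)
qed

lemma Ck_space_taylor:
  fixes f :: "real \<Rightarrow> 'a::banach"
  assumes ab: "a < b" and f: "f \<in> Ck_space k a b" and t: "t \<in> {a..b}"
  shows "f t = (\<Sum>j<k. frac_monom a (real j) t *\<^sub>R nderiv {a..b} j f a)
    + RL_integral (real k) a (nderiv {a..b} k f) t"
  using f
proof (induction k)
  case (Suc k)
  let ?D = "\<lambda>j. nderiv {a..b} j f"
  note D = Ck_space_SucD[OF Suc.prems]
  have cont: "continuous_on {a..b} (?D (Suc k))" "continuous_on {a..b} (?D k)"
    by (rule continuous_on_nderiv[OF Suc.prems], simp)+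
  \<comment> \<open>Expanding the last derivative once more by the fundamental theorem supplies the
    merged remainder.\<close>
  have ftc: "?D k s = ?D k a + RL_integral 1 a (?D (Suc k)) s" if s: "s \<in> {a..b}" for s
  proof -
    have "(?D (Suc k) has_integral ?D k s - ?D k a) {a..s}"
      using s by (intro fundamental_theorem_of_calculus has_vector_derivative_within_subset[OF D(2)]) auto
    then show ?thesis
      using s continuous_on_Icc_le[OF cont(1)] by (simp add: RL_integral_1 integral_unique del: nderiv.simps)
  qed
  have "RL_integral (real k) a (?D k) t = RL_integral (real k) a (\<lambda>s. ?D k a + RL_integral 1 a (?D (Suc k)) s) t"
    using t by (intro RL_integral_cong continuous_on_Icc_le[OF cont(2)] ftc) auto
  then show ?case
    using Suc.IH[OF D(1)] RL_integral_taylor_Suc[OF ab _ cont(1) t, of 1 "\<lambda>j. ?D j a" k]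
    by (simp add: add.commute del: nderiv.simps)
qed simp

text \<open>After merging the last term, the expansion of length \<open>k\<close> has the remainder
  density \<open>c k + RL_integral 1 a g\<close>. By induction this is the k-th derivative, so one
  more differentiation gives \<open>g\<close>, and evaluation at \<open>a\<close> gives
  \<open>c k\<close>.\<close>

lemma Ck_space_of_taylor:
  fixes f :: "real \<Rightarrow> 'a::banach"
  assumes ab: "a < b" and g: "continuous_on {a..b} g"
    and f: "\<And>t. t \<in> {a..b} \<Longrightarrow>
      f t = (\<Sum>j<k. frac_monom a (real j) t *\<^sub>R c j) + RL_integral (real k) a g t"
  shows "f \<in> Ck_space k a b \<and> (\<forall>t\<in>{a..b}. nderiv {a..b} k f t = g t) \<and> (\<forall>j<k. nderiv {a..b} j f a = c j)"
  using g f
proof (induction k arbitrary: g)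
  case 0
  then show ?case using continuous_on_cong[of "{a..b}" "{a..b}" f g] by (auto simp: Ck_space_def)
next
  case (Suc k)
  let ?g = "\<lambda>s. c k + RL_integral 1 a g s"
  let ?D = "\<lambda>j. nderiv {a..b} j f"
  have "f \<in> Ck_space k a b \<and> (\<forall>t\<in>{a..b}. ?D k t = ?g t) \<and> (\<forall>j<k. ?D j a = c j)"
  proof (rule Suc.IH)
    show "continuous_on {a..b} ?g"
      by (intro continuous_intros continuous_on_RL_integral ab Suc.prems) simp
    show "f t = (\<Sum>j<k. frac_monom a (real j) t *\<^sub>R c j) + RL_integral (real k) a ?g t"
      if t: "t \<in> {a..b}" for t
      using Suc.prems(2)[OF t] RL_integral_taylor_Suc[OF ab _ Suc.prems(1) t, of 1 c k]
      by (simp add: add.commute)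
  qed
  then have IH: "f \<in> Ck_space k a b" "\<And>t. t \<in> {a..b} \<Longrightarrow> ?D k t = ?g t" "\<And>j. j < k \<Longrightarrow> ?D j a = c j"
    by auto
  have D: "(?D k has_vector_derivative g t) (at t within {a..b})" if t: "t \<in> {a..b}" for t
  proof (rule has_vector_derivative_transform[OF t])
    show "(?g has_vector_derivative g t) (at t within {a..b})"
      using has_vector_derivative_add[OF has_vector_derivative_const
          RL_integral_1_has_vector_derivative[OF Suc.prems(1) t], of "c k"] by simp
  qed (rule IH(2))
  then have D': "?D (Suc k) t = g t" if "t \<in> {a..b}" for t
    using vector_derivative_within_Icc[OF ab that D[OF that]] by simp
  have "?D k differentiable (at t within {a..b})" if "t \<in> {a..b}" for t
    using D[OF that] differentiableI_vector by blast
  moreover have "continuous_on {a..b} (?D (Suc k))"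
    using Suc.prems(1) D' continuous_on_cong[of "{a..b}" "{a..b}" "?D (Suc k)" g] by blast
  ultimately have "f \<in> Ck_space (Suc k) a b"
    using IH(1) by (auto simp: Ck_space_def less_Suc_eq simp del: nderiv.simps)
  moreover have "?D k a = c k"
    using IH(2)[of a] ab by (simp add: RL_integral_left)
  ultimately show ?case
    using IH(3) D' by (auto simp: less_Suc_eq simp del: nderiv.simps)
qed

section \<open>Weak derivatives of continuous functions\<close>

lemma locally_bochner_integrable_continuous:
  fixes g :: "real \<Rightarrow> 'a::banach"
  assumes "continuous_on {a..b} g"
  shows "locally_bochner_integrable a b g"
  unfolding locally_bochner_integrable_def
proof (intro allI impI)
  fix c d assume cd: "a < c" "d < b"
  have "integrable (lebesgue_on {c..d}) (\<lambda>_. 1::real)"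
    by (intro absolutely_integrable_imp_integrable absolutely_integrable_continuous_real) auto
  moreover have "{c..d} \<subseteq> {a..b}" using cd by auto
  ultimately have "bochner_integrable (lebesgue_on {c..d}) (\<lambda>t. 1 *\<^sub>R g t)"
    using assms by (intro bochner_integrable_scaleR_continuous) auto
  then show "bochner_integrable (lebesgue_on {c..d}) g" by simp
qed

lemma bochner_int_Ioo_scaleR_continuous:
  fixes g :: "real \<Rightarrow> 'a::banach"
  assumes \<phi>: "continuous_on {a..b} \<phi>" and g: "continuous_on {a..b} g"
  shows "bochner_int (lebesgue_on {a<..<b}) (\<lambda>t. \<phi> t *\<^sub>R g t) = integral {a..b} (\<lambda>t. \<phi> t *\<^sub>R g t)"
proof -
  have "\<phi> absolutely_integrable_on {a<..<b}"
    using absolutely_integrable_continuous_real[OF \<phi>] by (rule set_integrable_subset) auto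
  then have "integrable (lebesgue_on {a<..<b}) \<phi>"
    by (intro absolutely_integrable_imp_integrable) auto
  then have "((\<lambda>t. \<phi> t *\<^sub>R g t) has_integral bochner_int (lebesgue_on {a<..<b}) (\<lambda>t. \<phi> t *\<^sub>R g t)) {a<..<b}"
    using g by (intro scaleR_continuous_has_integral) auto
  then show ?thesis
    by (simp add: integral_unique flip: has_integral_Icc_iff_Ioo)
qed

text \<open>The induction uses the test function \<open>deriv \<phi>\<close> and the merged
  remainder density, then one integration by parts removes the extra derivative and the constant
  \<open>c n\<close>.\<close>

lemma test_function_integral_taylor:
  fixes g :: "real \<Rightarrow> 'a::banach"
  assumes ab: "a < b" and h: "continuous_on {a..b} h" and \<phi>: "test_function a b \<phi>"
    and g: "\<And>t. t \<in> {a..b} \<Longrightarrow>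
      g t = (\<Sum>j<n. frac_monom a (real j) t *\<^sub>R c j) + RL_integral (real n) a h t"
  shows "integral {a..b} (\<lambda>t. (deriv ^^ n) \<phi> t *\<^sub>R g t) = (-1) ^ n *\<^sub>R integral {a..b} (\<lambda>t. \<phi> t *\<^sub>R h t)"
  using h \<phi> g
proof (induction n arbitrary: h \<phi>)
  case 0
  then have "integral {a..b} (\<lambda>t. \<phi> t *\<^sub>R g t) = integral {a..b} (\<lambda>t. \<phi> t *\<^sub>R h t)"
    by (intro Henstock_Kurzweil_Integration.integral_cong) simp
  then show ?case by simp
next
  case (Suc n)
  let ?h = "\<lambda>s. c n + RL_integral 1 a h s"
  have "integral {a..b} (\<lambda>t. (deriv ^^ n) (deriv \<phi>) t *\<^sub>R g t) = (-1) ^ n *\<^sub>R integral {a..b} (\<lambda>t. deriv \<phi> t *\<^sub>R ?h t)"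
  proof (rule Suc.IH)
    show "continuous_on {a..b} ?h"
      by (intro continuous_intros continuous_on_RL_integral ab Suc.prems) simp
    show "test_function a b (deriv \<phi>)"
      using Suc.prems by (intro test_function_deriv)
    show "g t = (\<Sum>j<n. frac_monom a (real j) t *\<^sub>R c j) + RL_integral (real n) a ?h t"
      if t: "t \<in> {a..b}" for t
      using Suc.prems(3)[OF t] RL_integral_taylor_Suc[OF ab _ Suc.prems(1) t, of 1 c n]
      by (simp add: add.commute)
  qed
  also have "integral {a..b} (\<lambda>t. deriv \<phi> t *\<^sub>R ?h t) = - integral {a..b} (\<lambda>t. \<phi> t *\<^sub>R h t)"
  proof (rule test_function_integral_by_parts[OF ab Suc.prems(2) _ Suc.prems(1)])
    show "(?h has_vector_derivative h t) (at t within {a..b})" if t: "t \<in> {a..b}" for t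
      using has_vector_derivative_add[OF has_vector_derivative_const
          RL_integral_1_has_vector_derivative[OF Suc.prems(1) t], of "c n"] by simp
  qed
  finally show ?case by (simp only: funpow_Suc_right comp_apply) simp
qed

text \<open>The n-fold integral of \<open>h\<close> itself has n-th weak derivative
  \<open>h\<close>. Subtracting it from \<open>g\<close> leaves a function annihilated by all n-th
  derivatives of test functions, hence a polynomial of degree below \<open>n\<close>.\<close>

lemma has_weak_deriv_iff_taylor:
  fixes g :: "real \<Rightarrow> 'a::banach"
  assumes ab: "a < b" and g: "continuous_on {a..b} g" and h: "continuous_on {a..b} h"
  shows "has_weak_deriv n a b g h \<longleftrightarrow> (\<exists>c. \<forall>t\<in>{a..b}.
    g t = (\<Sum>j<n. frac_monom a (real j) t *\<^sub>R c j) + RL_integral (real n) a h t)"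
proof -
  have cont: "continuous_on {a..b} ((deriv ^^ k) \<phi>)" if "test_function a b \<phi>" for k \<phi>
    using that by (intro smooth_continuous_on smooth_higher_deriv test_function_smooth)
  have "has_weak_deriv n a b g h \<longleftrightarrow> (\<forall>\<phi>. test_function a b \<phi> \<longrightarrow>
      integral {a..b} (\<lambda>t. (deriv ^^ n) \<phi> t *\<^sub>R g t) = (-1) ^ n *\<^sub>R integral {a..b} (\<lambda>t. \<phi> t *\<^sub>R h t))"
    unfolding has_weak_deriv_def
    using locally_bochner_integrable_continuous[OF g] locally_bochner_integrable_continuous[OF h]
      cont[where k=0] cont[where k=n]
    by (simp add: bochner_int_Ioo_scaleR_continuous[OF _ g] bochner_int_Ioo_scaleR_continuous[OF _ h])
  also have "\<dots> \<longleftrightarrow> (\<exists>c. \<forall>t\<in>{a..b}.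
      g t = (\<Sum>j<n. frac_monom a (real j) t *\<^sub>R c j) + RL_integral (real n) a h t)"
  proof
    assume L: "\<forall>\<phi>. test_function a b \<phi> \<longrightarrow>
      integral {a..b} (\<lambda>t. (deriv ^^ n) \<phi> t *\<^sub>R g t) = (-1) ^ n *\<^sub>R integral {a..b} (\<lambda>t. \<phi> t *\<^sub>R h t)"
    let ?J = "RL_integral (real n) a h"
    have J: "continuous_on {a..b} ?J" by (intro continuous_on_RL_integral ab h) simp
    have "\<exists>c. \<forall>t\<in>{a..b}. g t - ?J t = (\<Sum>j<n. ((t - a) ^ j / fact j) *\<^sub>R c j)"
    proof (rule du_Bois_Reymond[OF ab])
      show "continuous_on {a..b} (\<lambda>t. g t - ?J t)" by (intro continuous_intros g J)
      fix \<phi> assume \<phi>: "test_function a b \<phi>"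
      have "integral {a..b} (\<lambda>t. (deriv ^^ n) \<phi> t *\<^sub>R (g t - ?J t)) =
          integral {a..b} (\<lambda>t. (deriv ^^ n) \<phi> t *\<^sub>R g t) - integral {a..b} (\<lambda>t. (deriv ^^ n) \<phi> t *\<^sub>R ?J t)"
        unfolding scaleR_diff_right
        by (intro Henstock_Kurzweil_Integration.integral_diff integrable_continuous_real continuous_intros
            cont \<phi> g J)
      then show "integral {a..b} (\<lambda>t. (deriv ^^ n) \<phi> t *\<^sub>R (g t - ?J t)) = 0"
        \<comment> \<open>\<open>?J\<close> is its own expansion with all Taylor coefficients
          zero.\<close>
        using L \<phi> test_function_integral_taylor[OF ab h \<phi>, where g="?J" and n=n and c="\<lambda>_. 0"] by simp
    qed
    then obtain c where c: "\<And>t. t \<in> {a..b} \<Longrightarrow> g t - ?J t = (\<Sum>j<n. ((t - a) ^ j / fact j) *\<^sub>R c j)"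
      by blast
    have "g t = (\<Sum>j<n. frac_monom a (real j) t *\<^sub>R c j) + ?J t" if "t \<in> {a..b}" for t
      using c[OF that] that by (simp add: frac_monom_of_nat diff_eq_eq)
    then show "\<exists>c. \<forall>t\<in>{a..b}. g t = (\<Sum>j<n. frac_monom a (real j) t *\<^sub>R c j) + ?J t"
      by blast
  next
    assume "\<exists>c. \<forall>t\<in>{a..b}. g t = (\<Sum>j<n. frac_monom a (real j) t *\<^sub>R c j) + RL_integral (real n) a h t"
    then obtain c where "\<And>t. t \<in> {a..b} \<Longrightarrow>
        g t = (\<Sum>j<n. frac_monom a (real j) t *\<^sub>R c j) + RL_integral (real n) a h t" by blast
    then show "\<forall>\<phi>. test_function a b \<phi> \<longrightarrow>
      integral {a..b} (\<lambda>t. (deriv ^^ n) \<phi> t *\<^sub>R g t) = (-1) ^ n *\<^sub>R integral {a..b} (\<lambda>t. \<phi> t *\<^sub>R h t)"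
      using test_function_integral_taylor[OF ab h] by blast
  qed
  finally show ?thesis .
qed

section \<open>Caputo derivatives as fractional Taylor expansions\<close>

lemma has_Caputo_deriv_iff:
  fixes f :: "real \<Rightarrow> 'a::banach"
  assumes ab: "a < b" and \<beta>: "\<beta> > 0" and n: "n = nat \<lceil>\<beta>\<rceil>"
    and f: "f \<in> Ck_space (n - 1) a b" and h: "continuous_on {a..b} h"
  shows "has_Caputo_deriv \<beta> a b f h \<longleftrightarrow> (\<forall>t\<in>{a..b}.
    f t = (\<Sum>j<n. frac_monom a (real j) t *\<^sub>R nderiv {a..b} j f a) + RL_integral \<beta> a h t)"
proof -
  define m where "m = n - 1"
  have n0: "n > 0" using \<beta> by (simp add: n)
  then have nm: "n = Suc m" by (simp add: m_def)
  define \<gamma> where "\<gamma> = real n - \<beta>"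
  have ceil: "of_int \<lceil>\<beta>\<rceil> - \<beta> = \<gamma>" using \<beta> by (simp add: \<gamma>_def n)
  have \<gamma>: "\<gamma> \<ge> 0" unfolding ceil[symmetric] by simp
  let ?D = "\<lambda>j. nderiv {a..b} j f"
  define F where "F = (\<lambda>t. f t - (\<Sum>j<n. ((t - a) ^ j / fact j) *\<^sub>R ?D j a))"
  have F: "F t = f t - (\<Sum>j<n. frac_monom a (real j) t *\<^sub>R ?D j a)" if "t \<in> {a..b}" for t
    using that by (simp add: F_def frac_monom_of_nat)
  have contf: "continuous_on {a..b} f" using continuous_on_nderiv[OF f, of 0] by simp
  then have contF: "continuous_on {a..b} F"
    unfolding F_def by (intro continuous_intros) auto
  have contJ: "continuous_on {a..b} (RL_integral \<beta> a h)"
    using \<beta> by (intro continuous_on_RL_integral ab h) auto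
  have JJ: "RL_integral \<gamma> a (RL_integral \<beta> a h) t = RL_integral (real n) a h t" if "t \<in> {a..b}" for t
    using RL_integral_semigroup[OF ab h \<gamma>, of \<beta>] \<beta> that by (simp add: \<gamma>_def)
  have "has_Caputo_deriv \<beta> a b f h \<longleftrightarrow> has_weak_deriv n a b (RL_integral \<gamma> a F) h"
    by (simp add: has_Caputo_deriv_def has_RL_deriv_def ceil F_def n)
  also have "\<dots> \<longleftrightarrow> (\<exists>c. \<forall>t\<in>{a..b}. RL_integral \<gamma> a F t =
      (\<Sum>j<n. frac_monom a (real j) t *\<^sub>R c j) + RL_integral (real n) a h t)"
    by (intro has_weak_deriv_iff_taylor ab h continuous_on_RL_integral contF \<gamma>)
  also have "\<dots> \<longleftrightarrow> (\<forall>t\<in>{a..b}. F t = RL_integral \<beta> a h t)"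
  proof
    assume "\<forall>t\<in>{a..b}. F t = RL_integral \<beta> a h t"
    then have "RL_integral \<gamma> a F t = RL_integral (real n) a h t" if "t \<in> {a..b}" for t
      unfolding JJ[OF that, symmetric] using that
      by (intro RL_integral_cong \<gamma> continuous_on_Icc_le[OF contF]) auto
    then show "\<exists>c. \<forall>t\<in>{a..b}. RL_integral \<gamma> a F t =
        (\<Sum>j<n. frac_monom a (real j) t *\<^sub>R c j) + RL_integral (real n) a h t"
      by (intro exI[of _ "\<lambda>_. 0"]) simp
  next
    assume "\<exists>c. \<forall>t\<in>{a..b}. RL_integral \<gamma> a F t =
        (\<Sum>j<n. frac_monom a (real j) t *\<^sub>R c j) + RL_integral (real n) a h t"
    then obtain c where c: "\<And>t. t \<in> {a..b} \<Longrightarrow> RL_integral \<gamma> a F t =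
        (\<Sum>j<n. frac_monom a (real j) t *\<^sub>R c j) + RL_integral (real n) a h t" by blast
    \<comment> \<open>Taylor's formula makes \<open>F\<close> the m-fold integral of
      \<open>r\<close>, where \<open>m = n - 1\<close>. Thus the initial conditions of
      \<open>F\<close> are encoded in \<open>r a = 0\<close>; they will force the polynomial with
      coefficients \<open>c\<close> to vanish.\<close>
    define r where "r s = ?D m s - ?D m a" for s
    have contr: "continuous_on {a..b} r"
      unfolding r_def by (intro continuous_intros continuous_on_nderiv[OF f]) (simp add: m_def)
    have Fr: "F t = RL_integral (real m) a r t" if t: "t \<in> {a..b}" for t
    proof -
      have "continuous_on {a..t} (?D m)" using f t continuous_on_nderiv[OF f]
        by (auto simp: m_def intro: continuous_on_Icc_le)
      then have "RL_integral (real m) a r t = RL_integral (real m) a (?D m) t - frac_monom a (real m) t *\<^sub>R ?D m a"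
        unfolding r_def using t by (simp add: RL_integral_diff RL_integral_const)
      then show ?thesis
        using F[OF t] Ck_space_taylor[OF ab f[folded m_def] t] by (simp add: nm)
    qed
    let ?u = "RL_integral \<gamma> a r"
    have contu: "continuous_on {a..b} ?u" by (intro continuous_on_RL_integral ab contr \<gamma>)
    \<comment> \<open>For \<open>\<gamma> = 0\<close> this is \<open>r a = 0\<close>; for
      \<open>\<gamma> > 0\<close> every integral of positive order vanishes at
      \<open>a\<close>.\<close>
    have "?u a = 0"
      using RL_integral_left[of \<gamma> a r] \<gamma> by (cases "\<gamma> = 0") (auto simp: r_def)
    have g1: "RL_integral \<gamma> a F t = (\<Sum>j<m. frac_monom a (real j) t *\<^sub>R 0) + RL_integral (real m) a ?u t"
      if t: "t \<in> {a..b}" for t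
    proof -
      have "RL_integral \<gamma> a F t = RL_integral \<gamma> a (RL_integral (real m) a r) t"
        using t by (intro RL_integral_cong \<gamma> continuous_on_Icc_le[OF contF] Fr) auto
      also have "\<dots> = RL_integral (real m) a ?u t"
        using RL_integral_semigroup[OF ab contr \<gamma>, of "real m"]
          RL_integral_semigroup[OF ab contr _ \<gamma>, of "real m"] t by (simp add: add.commute)
      finally show ?thesis by simp
    qed
    \<comment> \<open>A second expansion of the same length as in \<open>g1\<close>. The derivatives
      at \<open>a\<close> below order \<open>m\<close> determine \<open>c j\<close> for
      \<open>j < m\<close>, and the m-th derivative at \<open>a\<close> determines
      \<open>c m\<close>; all are 0.\<close>
    have g2: "RL_integral \<gamma> a F t =
        (\<Sum>j<m. frac_monom a (real j) t *\<^sub>R c j) + RL_integral (real m) a (\<lambda>s. c m + RL_integral 1 a h s) t"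
      if t: "t \<in> {a..b}" for t
      using c[OF t] RL_integral_taylor_Suc[OF ab _ h t, of 1 c m] by (simp add: nm add.commute)
    have "continuous_on {a..b} (\<lambda>s. c m + RL_integral 1 a h s)"
      by (intro continuous_intros continuous_on_RL_integral ab h) simp
    from Ck_space_of_taylor[OF ab this g2] Ck_space_of_taylor[OF ab contu g1]
    have "c m + RL_integral 1 a h a = ?u a" "\<And>j. j < m \<Longrightarrow> c j = 0"
      using ab by fastforce+
    then have "c j = 0" if "j < n" for j
      using that \<open>?u a = 0\<close> by (auto simp: nm less_Suc_eq RL_integral_left)
    then have "RL_integral \<gamma> a F t = RL_integral \<gamma> a (RL_integral \<beta> a h) t" if "t \<in> {a..b}" for t
      using c[OF that] JJ[OF that] by simp
    \<comment> \<open>Without the polynomial, injectivity of the integral of order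
      \<open>\<gamma>\<close> can be applied.\<close>
    then show "\<forall>t\<in>{a..b}. F t = RL_integral \<beta> a h t"
      using RL_integral_inject[OF ab contF contJ \<gamma>] by blast
  qed
  also have "\<dots> \<longleftrightarrow> (\<forall>t\<in>{a..b}. f t = (\<Sum>j<n. frac_monom a (real j) t *\<^sub>R ?D j a) + RL_integral \<beta> a h t)"
    by (intro ball_cong refl) (simp only: F diff_eq_eq add.commute)
  finally show ?thesis .
qed

text \<open>Writing \<open>\<beta> = m + \<delta>\<close> with \<open>m = n - 1\<close> turns the
  expansion into one of integer order whose m-th derivative is \<open>c m\<close> plus the integral
  of order \<open>\<delta>\<close> of \<open>h\<close>. The latter vanishes at \<open>a\<close>
  because \<open>\<delta> > 0\<close>, so the coefficients are the derivatives at
  \<open>a\<close>.\<close>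

lemma fractional_taylor_imp:
  fixes f :: "real \<Rightarrow> 'a::banach"
  assumes ab: "a < b" and \<beta>: "\<beta> > 0" and n: "n = nat \<lceil>\<beta>\<rceil>" and h: "continuous_on {a..b} h"
    and f: "\<And>t. t \<in> {a..b} \<Longrightarrow>
      f t = (\<Sum>j<n. frac_monom a (real j) t *\<^sub>R c j) + RL_integral \<beta> a h t"
  shows "f \<in> Ck_space (n - 1) a b"
    and "\<And>j. j < n \<Longrightarrow> nderiv {a..b} j f a = c j"
    and "has_Caputo_deriv \<beta> a b f h"
    and "\<And>t. t \<in> {a..b} \<Longrightarrow> Caputo_deriv \<beta> a b f t = h t"
proof -
  define m where "m = n - 1"
  have "n > 0" using \<beta> by (simp add: n)
  then have nm: "n = Suc m" by (simp add: m_def)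
  define \<delta> where "\<delta> = \<beta> - real m"
  have \<delta>: "\<delta> > 0" using nm n by (simp add: \<delta>_def) linarith
  let ?g = "\<lambda>s. c m + RL_integral \<delta> a h s"
  have "continuous_on {a..b} ?g"
    using \<delta> by (intro continuous_intros continuous_on_RL_integral ab h) auto
  moreover have "f t = (\<Sum>j<m. frac_monom a (real j) t *\<^sub>R c j) + RL_integral (real m) a ?g t"
    if t: "t \<in> {a..b}" for t
    using f[OF t] RL_integral_taylor_Suc[OF ab _ h t, of \<delta> c m] \<delta> by (simp add: nm \<delta>_def)
  ultimately have *: "f \<in> Ck_space m a b \<and> (\<forall>t\<in>{a..b}. nderiv {a..b} m f t = ?g t) \<and>
      (\<forall>j<m. nderiv {a..b} j f a = c j)"
    by (rule Ck_space_of_taylor[OF ab])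
  then show Ck: "f \<in> Ck_space (n - 1) a b" by (simp add: m_def)
  show nderiv: "nderiv {a..b} j f a = c j" if "j < n" for j
    using * that ab \<delta> by (cases "j = m") (auto simp: nm RL_integral_left less_Suc_eq)
  note iff = has_Caputo_deriv_iff[OF ab \<beta> n Ck]
  show C: "has_Caputo_deriv \<beta> a b f h"
    using f nderiv by (simp add: iff[OF h])
  \<comment> \<open>Any choice made by \<open>SOME\<close> satisfies the same expansion, so
    injectivity identifies it with \<open>h\<close> on \<open>{a..b}\<close>.\<close>
  define k where "k = Caputo_deriv \<beta> a b f"
  have k: "continuous_on {a..b} k" "has_Caputo_deriv \<beta> a b f k"
    using someI_ex[of "\<lambda>h. continuous_on {a..b} h \<and> has_Caputo_deriv \<beta> a b f h"] h C
    by (auto simp: k_def Caputo_deriv_def)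
  have "RL_integral \<beta> a k t = RL_integral \<beta> a h t" if "t \<in> {a..b}" for t
    using k(2) C that unfolding iff[OF h] iff[OF k(1)] by auto
  then show "Caputo_deriv \<beta> a b f t = h t" if "t \<in> {a..b}" for t
    unfolding k_def[symmetric] using \<beta> by (intro RL_integral_inject[where \<alpha>=\<beta>, OF ab k(1) h _ _ that]) auto
qed

text \<open>This form also covers \<open>\<beta> = 0\<close>, where the sum is empty and the
  integral of order 0 is the identity.\<close>

lemma mem_Calpha_space_iff:
  fixes f :: "real \<Rightarrow> 'a::banach"
  assumes ab: "a < b" and \<beta>: "\<beta> \<ge> 0" and n: "n = nat \<lceil>\<beta>\<rceil>"
  shows "f \<in> Calpha_space \<beta> a b \<longleftrightarrow> (\<exists>c h. continuous_on {a..b} h \<and>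
    (\<forall>t\<in>{a..b}. f t = (\<Sum>j<n. frac_monom a (real j) t *\<^sub>R c j) + RL_integral \<beta> a h t))"
proof (cases "\<beta> = 0")
  case True
  have "continuous_on {a..b} f" if "continuous_on {a..b} h" "\<forall>t\<in>{a..b}. f t = h t" for h
    using that continuous_on_cong[of "{a..b}" "{a..b}" f h] by simp
  then show ?thesis
    using True n by (auto simp: Calpha_space_def Ck_space_def)
next
  case False
  with \<beta> have \<beta>: "\<beta> > 0" by simp
  show ?thesis
  proof
    assume "f \<in> Calpha_space \<beta> a b"
    then obtain h where h: "f \<in> Ck_space (n - 1) a b" "continuous_on {a..b} h" "has_Caputo_deriv \<beta> a b f h"
      using \<beta> n by (auto simp: Calpha_space_def Caputo_continuous_def)
    then show "\<exists>c h. continuous_on {a..b} h \<and>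
        (\<forall>t\<in>{a..b}. f t = (\<Sum>j<n. frac_monom a (real j) t *\<^sub>R c j) + RL_integral \<beta> a h t)"
      using has_Caputo_deriv_iff[OF ab \<beta> n h(1,2)] by (intro exI[of _ "\<lambda>j. nderiv {a..b} j f a"] exI[of _ h]) simp
  next
    assume "\<exists>c h. continuous_on {a..b} h \<and>
        (\<forall>t\<in>{a..b}. f t = (\<Sum>j<n. frac_monom a (real j) t *\<^sub>R c j) + RL_integral \<beta> a h t)"
    then obtain c h where h: "continuous_on {a..b} h" and
      f: "\<And>t. t \<in> {a..b} \<Longrightarrow> f t = (\<Sum>j<n. frac_monom a (real j) t *\<^sub>R c j) + RL_integral \<beta> a h t"
      by blast
    from fractional_taylor_imp(1,3)[OF ab \<beta> n h f] h \<beta> n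
    show "f \<in> Calpha_space \<beta> a b"
      by (auto simp: Calpha_space_def Caputo_continuous_def)
  qed
qed

section \<open>Inclusion and strictness\<close>

lemma norm_le_sup_norm:
  assumes "continuous_on {a..b} f" "t \<in> {a..b}"
  shows "norm (f t) \<le> sup_norm a b f"
proof -
  have "compact ((\<lambda>t. norm (f t)) ` {a..b})"
    using assms(1) by (intro compact_continuous_image continuous_intros) auto
  then have "bdd_above ((\<lambda>t. norm (f t)) ` {a..b})"
    by (intro bounded_imp_bdd_above compact_imp_bounded)
  then show ?thesis
    unfolding sup_norm_def using assms(2) by (rule cSUP_upper[rotated])
qed

lemma sup_norm_le:
  assumes "a \<le> b" "\<And>t. t \<in> {a..b} \<Longrightarrow> norm (f t) \<le> B"
  shows "sup_norm a b f \<le> B"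
  unfolding sup_norm_def using assms by (intro cSUP_least) auto

lemma sup_norm_cong: "(\<And>t. t \<in> {a..b} \<Longrightarrow> f t = g t) \<Longrightarrow> sup_norm a b f = sup_norm a b g"
  unfolding sup_norm_def by (intro arg_cong[where f=Sup] image_cong) auto

lemma sup_norm_nonneg:
  assumes "a \<le> b" "continuous_on {a..b} f"
  shows "0 \<le> sup_norm a b f"
  by (rule order_trans[OF norm_ge_zero norm_le_sup_norm[OF assms(2), of a]]) (use assms(1) in simp)

text \<open>The Caputo derivative of order \<open>\<alpha>\<close> of the function with Taylor coefficients \<open>c\<close> and
  Caputo derivative \<open>h\<close> of order \<open>\<beta>\<close>.\<close>
definition lower_Caputo :: "real \<Rightarrow> real \<Rightarrow> real \<Rightarrow> (nat \<Rightarrow> 'a::banach) \<Rightarrow> (real \<Rightarrow> 'a) \<Rightarrow> real \<Rightarrow> 'a" where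
  "lower_Caputo a \<alpha> \<beta> c h t =
    (\<Sum>j=nat \<lceil>\<alpha>\<rceil>..<nat \<lceil>\<beta>\<rceil>. frac_monom a (real j - \<alpha>) t *\<^sub>R c j) + RL_integral (\<beta> - \<alpha>) a h t"

lemma le_of_nat_ceiling: "nat \<lceil>\<alpha>\<rceil> \<le> j \<Longrightarrow> \<alpha> \<le> real j"
  by linarith

lemma continuous_on_lower_Caputo:
  fixes h :: "real \<Rightarrow> 'a::banach"
  assumes "a < b" "\<alpha> \<le> \<beta>" "continuous_on {a..b} h"
  shows "continuous_on {a..b} (lower_Caputo a \<alpha> \<beta> c h)"
  unfolding lower_Caputo_def[abs_def]
  using assms le_of_nat_ceiling
  by (intro continuous_on_add continuous_on_sum continuous_on_scaleR continuous_on_const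
      continuous_on_frac_monom continuous_on_RL_integral) auto

text \<open>Integration of order \<open>\<alpha>\<close> raises \<open>j - \<alpha>\<close> to
  \<open>j\<close> and \<open>\<beta> - \<alpha>\<close> to \<open>\<beta>\<close>. It thus recovers
  the terms with index at least the ceiling of \<open>\<alpha>\<close> and the remainder; the
  earlier terms stay as the Taylor polynomial of order \<open>\<alpha>\<close>.\<close>

lemma taylor_lower_Caputo:
  fixes h :: "real \<Rightarrow> 'a::banach"
  assumes ab: "a < b" and \<alpha>: "0 \<le> \<alpha>" "\<alpha> \<le> \<beta>" and h: "continuous_on {a..b} h" and t: "t \<in> {a..b}"
  shows "(\<Sum>j<nat \<lceil>\<beta>\<rceil>. frac_monom a (real j) t *\<^sub>R c j) + RL_integral \<beta> a h t =
    (\<Sum>j<nat \<lceil>\<alpha>\<rceil>. frac_monom a (real j) t *\<^sub>R c j) + RL_integral \<alpha> a (lower_Caputo a \<alpha> \<beta> c h) t"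
proof -
  let ?I = "{nat \<lceil>\<alpha>\<rceil>..<nat \<lceil>\<beta>\<rceil>}"
  have cont1: "continuous_on {a..t} (\<lambda>t. frac_monom a (real j - \<alpha>) t *\<^sub>R c j)" if "j \<in> ?I" for j
    using that le_of_nat_ceiling[of \<alpha> j] by (intro continuous_intros continuous_on_frac_monom) auto
  have cont2: "continuous_on {a..t} (RL_integral (\<beta> - \<alpha>) a h)"
    using t \<alpha> by (intro continuous_on_Icc_le[OF continuous_on_RL_integral[OF ab h]]) auto
  have "RL_integral \<alpha> a (lower_Caputo a \<alpha> \<beta> c h) t =
      RL_integral \<alpha> a (\<lambda>t. \<Sum>j\<in>?I. frac_monom a (real j - \<alpha>) t *\<^sub>R c j) t
      + RL_integral \<alpha> a (RL_integral (\<beta> - \<alpha>) a h) t"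
    unfolding lower_Caputo_def[abs_def] using t \<alpha> cont1 cont2
    by (intro RL_integral_add continuous_on_sum) auto
  also have "RL_integral \<alpha> a (\<lambda>t. \<Sum>j\<in>?I. frac_monom a (real j - \<alpha>) t *\<^sub>R c j) t =
      (\<Sum>j\<in>?I. RL_integral \<alpha> a (\<lambda>t. frac_monom a (real j - \<alpha>) t *\<^sub>R c j) t)"
    using t \<alpha> cont1 by (intro RL_integral_sum) auto
  also have "\<dots> = (\<Sum>j\<in>?I. frac_monom a (real j) t *\<^sub>R c j)"
  proof (rule sum.cong[OF refl])
    fix j assume "j \<in> ?I"
    then have "\<alpha> \<le> real j" using le_of_nat_ceiling by auto
    then show "RL_integral \<alpha> a (\<lambda>t. frac_monom a (real j - \<alpha>) t *\<^sub>R c j) t = frac_monom a (real j) t *\<^sub>R c j"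
      using t \<alpha> RL_integral_frac_monom[of \<alpha> "real j - \<alpha>" a t "c j"] by simp
  qed
  also have "RL_integral \<alpha> a (RL_integral (\<beta> - \<alpha>) a h) t = RL_integral \<beta> a h t"
    using RL_integral_semigroup[OF ab h, of \<alpha> "\<beta> - \<alpha>"] t \<alpha> by simp
  finally have *: "RL_integral \<alpha> a (lower_Caputo a \<alpha> \<beta> c h) t =
      (\<Sum>j\<in>?I. frac_monom a (real j) t *\<^sub>R c j) + RL_integral \<beta> a h t" .
  have "nat \<lceil>\<alpha>\<rceil> \<le> nat \<lceil>\<beta>\<rceil>" using \<alpha> by (intro nat_mono ceiling_mono) auto
  then have "(\<Sum>j<nat \<lceil>\<beta>\<rceil>. frac_monom a (real j) t *\<^sub>R c j) =
      (\<Sum>j<nat \<lceil>\<alpha>\<rceil>. frac_monom a (real j) t *\<^sub>R c j) + (\<Sum>j\<in>?I. frac_monom a (real j) t *\<^sub>R c j)"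
    by (simp add: sum.atLeastLessThan_concat flip: atLeast0LessThan)
  with * show ?thesis by simp
qed

text \<open>Fractional monomials of nonnegative order increase on \<open>{a..b}\<close>, so each is
  bounded by its value at \<open>b\<close>.\<close>

lemma sup_norm_lower_Caputo_le:
  fixes h :: "real \<Rightarrow> 'a::banach"
  assumes ab: "a < b" and \<alpha>: "\<alpha> \<le> \<beta>" and h: "continuous_on {a..b} h"
  shows "sup_norm a b (lower_Caputo a \<alpha> \<beta> c h) \<le>
    (\<Sum>j=nat \<lceil>\<alpha>\<rceil>..<nat \<lceil>\<beta>\<rceil>. frac_monom a (real j - \<alpha>) b * norm (c j)) + frac_monom a (\<beta> - \<alpha>) b * sup_norm a b h"
proof (rule sup_norm_le)
  fix t assume t: "t \<in> {a..b}"
  have "norm (\<Sum>j=nat \<lceil>\<alpha>\<rceil>..<nat \<lceil>\<beta>\<rceil>. frac_monom a (real j - \<alpha>) t *\<^sub>R c j) \<le>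
      (\<Sum>j=nat \<lceil>\<alpha>\<rceil>..<nat \<lceil>\<beta>\<rceil>. frac_monom a (real j - \<alpha>) b * norm (c j))"
  proof (rule sum_norm_le)
    fix j assume "j \<in> {nat \<lceil>\<alpha>\<rceil>..<nat \<lceil>\<beta>\<rceil>}"
    then have "real j - \<alpha> \<ge> 0" using le_of_nat_ceiling[of \<alpha> j] by simp
    then show "norm (frac_monom a (real j - \<alpha>) t *\<^sub>R c j) \<le> frac_monom a (real j - \<alpha>) b * norm (c j)"
      using t by (simp add: frac_monom_nonneg frac_monom_mono mult_right_mono)
  qed
  moreover have "norm (RL_integral (\<beta> - \<alpha>) a h t) \<le> frac_monom a (\<beta> - \<alpha>) t * sup_norm a b h"
    using t \<alpha> by (intro norm_RL_integral_le continuous_on_Icc_le[OF h] norm_le_sup_norm[OF h]) auto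
  moreover have "\<dots> \<le> frac_monom a (\<beta> - \<alpha>) b * sup_norm a b h"
    using t \<alpha> ab h by (intro mult_right_mono frac_monom_mono sup_norm_nonneg) auto
  ultimately show "norm (lower_Caputo a \<alpha> \<beta> c h t) \<le>
      (\<Sum>j=nat \<lceil>\<alpha>\<rceil>..<nat \<lceil>\<beta>\<rceil>. frac_monom a (real j - \<alpha>) b * norm (c j)) + frac_monom a (\<beta> - \<alpha>) b * sup_norm a b h"
    unfolding lower_Caputo_def by (intro order_trans[OF norm_triangle_ineq]) linarith
qed (use ab in simp)

text \<open>It vanishes at \<open>a\<close> more slowly than any positive power of \<open>t - a\<close>.\<close>
definition log_modulus :: "real \<Rightarrow> real \<Rightarrow> real \<Rightarrow> real" where
  "log_modulus a b t = (if t \<le> a then 0 else 1 / (1 + ln ((b - a) / (t - a))))"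

lemma log_modulus_denominator_pos:
  fixes a b t :: real
  assumes "a < t" "t \<le> b"
  shows "1 + ln ((b - a) / (t - a)) > 0"
proof -
  have "ln ((b - a) / (t - a)) \<ge> 0" using assms by (intro ln_ge_zero) (simp add: field_simps)
  then show ?thesis by linarith
qed

lemma at_right_shift:
  fixes f :: "real \<Rightarrow> real"
  assumes "(f \<longlongrightarrow> l) (at_right 0)"
  shows "((\<lambda>t. f (t - a)) \<longlongrightarrow> l) (at_right a)"
proof -
  have "filterlim (\<lambda>t. t - a) (at_right 0) (at_right a)"
    unfolding filterlim_at
    by (auto intro!: tendsto_eq_intros simp: eventually_at_filter)
  with assms show ?thesis by (rule filterlim_compose)
qed

lemma continuous_on_log_modulus:
  assumes ab: "a < b"
  shows "continuous_on {a..b} (log_modulus a b)"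
  unfolding continuous_on_eq_continuous_within
proof
  fix t assume t: "t \<in> {a..b}"
  show "continuous (at t within {a..b}) (log_modulus a b)"
  proof (cases "t = a")
    case True
    \<comment> \<open>The logarithm tends to infinity at 0, which gives continuity at the left end
      with value 0.\<close>
    have "((\<lambda>u. 1 / (1 + ln ((b - a) / u))) \<longlongrightarrow> 0) (at_right 0)"
      using ab by real_asymp
    from at_right_shift[OF this, of a]
    have "(log_modulus a b \<longlongrightarrow> 0) (at_right a)"
      by (rule Lim_transform_eventually)
        (auto simp: eventually_at_filter log_modulus_def)
    then show ?thesis
      using ab True by (simp add: continuous_within at_within_Icc_at_right log_modulus_def)
  next
    case False
    with t have t: "a < t" "t \<le> b" by auto
    have "continuous (at t) (\<lambda>t. 1 / (1 + ln ((b - a) / (t - a))))"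
      using t log_modulus_denominator_pos[OF t] ab by (intro continuous_intros) auto
    then have "isCont (log_modulus a b) t"
    proof (rule isCont_cong[THEN iffD1, rotated])
      show "\<forall>\<^sub>F x in nhds t. 1 / (1 + ln ((b - a) / (x - a))) = log_modulus a b x"
        using eventually_nhds_in_open[of "{a<..}" t] t
        by (auto elim!: eventually_mono simp: log_modulus_def)
    qed
    then show ?thesis by (rule continuous_at_imp_continuous_within)
  qed
qed

lemma frac_monom_over_log_modulus:
  assumes ab: "a < b" and \<gamma>: "\<gamma> > 0"
  shows "((\<lambda>t. frac_monom a \<gamma> t / log_modulus a b t) \<longlongrightarrow> 0) (at_right a)"
proof -
  have "((\<lambda>u. u powr \<gamma> * (1 + ln ((b - a) / u)) / Gamma (\<gamma> + 1)) \<longlongrightarrow> 0) (at_right 0)"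
  proof -
    have "((\<lambda>u. u powr \<gamma> * (1 + ln ((b - a) / u))) \<longlongrightarrow> 0) (at_right 0)"
      using ab \<gamma> by real_asymp
    from tendsto_divide[OF this tendsto_const, of "Gamma (\<gamma> + 1)"] \<gamma>
    show ?thesis by (simp add: Gamma_pos_nonzero)
  qed
  from at_right_shift[OF this, of a] show ?thesis
    by (rule Lim_transform_eventually)
      (use \<gamma> in \<open>auto simp: eventually_at_filter log_modulus_def frac_monom_def\<close>)
qed

text \<open>Every nonconstant term of \<open>lower_Caputo\<close> is bounded near \<open>a\<close>
  by a positive power of \<open>t - a\<close>, hence is negligible against
  \<open>log_modulus\<close>; the constant term vanishes because \<open>log_modulus\<close> does at
  \<open>a\<close>.\<close>

lemma log_modulus_not_lower_Caputo:
  fixes x :: "'a::banach"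
  assumes ab: "a < b" and \<alpha>: "\<alpha> < \<beta>" and h: "continuous_on {a..b} h"
    and eq: "\<And>t. t \<in> {a..b} \<Longrightarrow> log_modulus a b t *\<^sub>R x = lower_Caputo a \<alpha> \<beta> c h t"
  shows "x = 0"
proof -
  let ?I = "{nat \<lceil>\<alpha>\<rceil>..<nat \<lceil>\<beta>\<rceil>}"
  let ?k = "log_modulus a b"
  have Ige: "real j - \<alpha> \<ge> 0" if "j \<in> ?I" for j
    using that le_of_nat_ceiling[of \<alpha> j] by simp
  \<comment> \<open>Such a \<open>j\<close> exists only for integer \<open>\<alpha>\<close>; its
    fractional monomial has order 0 and is the only term surviving evaluation at
    \<open>a\<close>.\<close>
  have c0: "c j = 0" if j: "j \<in> ?I" "real j = \<alpha>" for j
  proof -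
    have "(\<Sum>i\<in>?I. frac_monom a (real i - \<alpha>) a *\<^sub>R c i) = (\<Sum>i\<in>?I. if i = j then c j else 0)"
      using j by (intro sum.cong) (auto simp: frac_monom_left)
    then have "lower_Caputo a \<alpha> \<beta> c h a = c j"
      using j \<alpha> by (simp add: lower_Caputo_def RL_integral_left)
    then show ?thesis using eq[of a] ab by (simp add: log_modulus_def)
  qed
  define R where "R t = (\<Sum>j\<in>?I. frac_monom a (real j - \<alpha>) t * norm (c j)) + frac_monom a (\<beta> - \<alpha>) t * sup_norm a b h" for t
  have le: "norm x \<le> R t / ?k t" if t: "a < t" "t \<le> b" for t
  proof -
    have pos: "?k t > 0" using t log_modulus_denominator_pos[OF t] by (simp add: log_modulus_def)
    have "norm (\<Sum>j\<in>?I. frac_monom a (real j - \<alpha>) t *\<^sub>R c j) \<le>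
        (\<Sum>j\<in>?I. frac_monom a (real j - \<alpha>) t * norm (c j))"
      using Ige by (intro sum_norm_le) (simp add: frac_monom_nonneg)
    moreover have "norm (RL_integral (\<beta> - \<alpha>) a h t) \<le> frac_monom a (\<beta> - \<alpha>) t * sup_norm a b h"
      using t \<alpha> by (intro norm_RL_integral_le continuous_on_Icc_le[OF h] norm_le_sup_norm[OF h]) auto
    ultimately have "norm (lower_Caputo a \<alpha> \<beta> c h t) \<le> R t"
      unfolding lower_Caputo_def R_def by (intro order_trans[OF norm_triangle_ineq]) linarith
    then have "?k t * norm x \<le> R t" using eq[of t] t pos by (metis abs_of_pos atLeastAtMost_iff less_imp_le norm_scaleR)
    then show ?thesis using pos by (simp add: field_simps)
  qed
  have "((\<lambda>t. (\<Sum>j\<in>?I. frac_monom a (real j - \<alpha>) t / ?k t * norm (c j))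
      + frac_monom a (\<beta> - \<alpha>) t / ?k t * sup_norm a b h) \<longlongrightarrow> (\<Sum>j\<in>?I. 0) + 0 * sup_norm a b h) (at_right a)"
  proof (intro tendsto_add tendsto_sum tendsto_mult tendsto_const)
    show "((\<lambda>t. frac_monom a (\<beta> - \<alpha>) t / ?k t) \<longlongrightarrow> 0) (at_right a)"
      using \<alpha> by (intro frac_monom_over_log_modulus ab) simp
    fix j assume j: "j \<in> ?I"
    show "((\<lambda>t. frac_monom a (real j - \<alpha>) t / ?k t * norm (c j)) \<longlongrightarrow> 0) (at_right a)"
    proof (cases "real j = \<alpha>")
      case False
      then have "((\<lambda>t. frac_monom a (real j - \<alpha>) t / ?k t) \<longlongrightarrow> 0) (at_right a)"
        using Ige[OF j] by (intro frac_monom_over_log_modulus ab) simp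
      then show ?thesis by (rule tendsto_mult_left_zero)
    qed (use c0 j in simp)
  qed
  then have "((\<lambda>t. R t / ?k t) \<longlongrightarrow> 0) (at_right a)"
    by (simp add: R_def add_divide_distrib sum_divide_distrib)
  moreover have "\<forall>\<^sub>F t in at_right a. norm x \<le> R t / ?k t"
    using eventually_at_right_less[of a] eventually_at_right_real[OF ab]
    by eventually_elim (use le in auto)
  ultimately have "norm x \<le> 0"
    by (rule tendsto_lowerbound) simp
  then show ?thesis by simp
qed

theorem theorem14:
  fixes t0 t1 \<alpha> \<beta> :: real
  assumes "\<exists>x::'a::banach. x \<noteq> 0"
    and "t0 < t1"
    and "0 \<le> \<alpha>" and "\<alpha> < \<beta>"
  shows "(Calpha_space \<beta> t0 t1 :: (real \<Rightarrow> 'a) set) \<subset> Calpha_space \<alpha> t0 t1 \<and>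
    (\<exists>M>0. \<forall>f\<in>(Calpha_space \<beta> t0 t1 :: (real \<Rightarrow> 'a) set).
      Calpha_norm \<alpha> t0 t1 f \<le> M * Calpha_norm \<beta> t0 t1 f)"
proof -
  note ab = \<open>t0 < t1\<close>
  define m n where "m = nat \<lceil>\<alpha>\<rceil>" and "n = nat \<lceil>\<beta>\<rceil>"
  have \<beta>: "\<beta> > 0" and \<alpha>\<beta>: "\<alpha> \<le> \<beta>" using assms by auto
  have n0: "n > 0" using \<beta> by (simp add: n_def)
  have mn: "m \<le> n" unfolding m_def n_def using \<alpha>\<beta> by (intro nat_mono ceiling_mono)
  let ?low = "lower_Caputo t0 \<alpha> \<beta>"
  have rep: "\<exists>c h. continuous_on {t0..t1} h \<and> (\<forall>t\<in>{t0..t1}. f t =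
      (\<Sum>j<n. frac_monom t0 (real j) t *\<^sub>R c j) + RL_integral \<beta> t0 h t)"
    if "f \<in> Calpha_space \<beta> t0 t1" for f :: "real \<Rightarrow> 'a"
    using that mem_Calpha_space_iff[OF ab _ n_def] \<beta> by auto
  \<comment> \<open>A representation of order \<open>\<beta>\<close> is reread as one of order
    \<open>\<alpha>\<close> with density \<open>?low c h\<close>.\<close>
  have lower: "f t = (\<Sum>j<m. frac_monom t0 (real j) t *\<^sub>R c j) + RL_integral \<alpha> t0 (?low c h) t"
    if "continuous_on {t0..t1} h" "\<forall>t\<in>{t0..t1}. f t =
      (\<Sum>j<n. frac_monom t0 (real j) t *\<^sub>R c j) + RL_integral \<beta> t0 h t" "t \<in> {t0..t1}"
    for f h c and t :: real
    using taylor_lower_Caputo[OF ab assms(3) \<alpha>\<beta> that(1,3), of c] that(2,3) by (simp add: m_def n_def)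
  have cont: "continuous_on {t0..t1} (?low c h)" if "continuous_on {t0..t1} h" for c and h :: "real \<Rightarrow> 'a"
    using that by (intro continuous_on_lower_Caputo ab \<alpha>\<beta>)

  have "Calpha_space \<beta> t0 t1 \<subseteq> (Calpha_space \<alpha> t0 t1 :: (real \<Rightarrow> 'a) set)"
  proof
    fix f :: "real \<Rightarrow> 'a" assume "f \<in> Calpha_space \<beta> t0 t1"
    then obtain c h where "continuous_on {t0..t1} h" "\<forall>t\<in>{t0..t1}. f t =
      (\<Sum>j<n. frac_monom t0 (real j) t *\<^sub>R c j) + RL_integral \<beta> t0 h t" using rep by blast
    with lower cont show "f \<in> Calpha_space \<alpha> t0 t1"
      unfolding mem_Calpha_space_iff[OF ab assms(3) m_def] by blast
  qed
  moreover have "Calpha_space \<beta> t0 t1 \<noteq> (Calpha_space \<alpha> t0 t1 :: (real \<Rightarrow> 'a) set)"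
  proof
    assume same: "Calpha_space \<beta> t0 t1 = (Calpha_space \<alpha> t0 t1 :: (real \<Rightarrow> 'a) set)"
    obtain x :: 'a where "x \<noteq> 0" using assms(1) by blast
    let ?k = "\<lambda>t. log_modulus t0 t1 t *\<^sub>R x"
    have k: "continuous_on {t0..t1} ?k"
      by (intro continuous_intros continuous_on_log_modulus ab)
    \<comment> \<open>The witness for strictness has zero Taylor coefficients and Caputo derivative
      \<open>?k\<close> of order \<open>\<alpha>\<close>, which is too irregular at
      \<open>t0\<close> for order \<open>\<beta>\<close>.\<close>
    let ?f = "RL_integral \<alpha> t0 ?k"
    have f: "?f t = (\<Sum>j<m. frac_monom t0 (real j) t *\<^sub>R 0) + RL_integral \<alpha> t0 ?k t" for t
      by simp
    then have "?f \<in> Calpha_space \<alpha> t0 t1"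
      unfolding mem_Calpha_space_iff[OF ab assms(3) m_def] using k
      by (intro exI[of _ "\<lambda>_. 0"] exI[of _ ?k]) simp
    then obtain c h where h: "continuous_on {t0..t1} h" and "\<forall>t\<in>{t0..t1}. ?f t =
        (\<Sum>j<n. frac_monom t0 (real j) t *\<^sub>R c j) + RL_integral \<beta> t0 h t"
      using rep same by blast
    note g = lower[OF this]
    \<comment> \<open>The Caputo derivative of order \<open>\<alpha>\<close> is computed from both
      representations of \<open>?f\<close>; for \<open>\<alpha> = 0\<close> both sides are
      \<open>?f\<close> itself.\<close>
    have "?k t = ?low c h t" if t: "t \<in> {t0..t1}" for t
    proof (cases "\<alpha> = 0")
      case True
      then show ?thesis using g[OF t] by (simp add: m_def)
    next
      case False
      with assms(3) have "\<alpha> > 0" by simp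
      from fractional_taylor_imp(4)[OF ab this m_def k f t] fractional_taylor_imp(4)[OF ab this m_def cont[OF h] g t]
      show ?thesis by simp
    qed
    with log_modulus_not_lower_Caputo[OF ab \<open>\<alpha> < \<beta>\<close> h] \<open>x \<noteq> 0\<close> show False by blast
  qed
  moreover have "\<exists>M>0. \<forall>f\<in>(Calpha_space \<beta> t0 t1 :: (real \<Rightarrow> 'a) set).
      Calpha_norm \<alpha> t0 t1 f \<le> M * Calpha_norm \<beta> t0 t1 f"
  proof (intro exI conjI ballI)
    define S where "S = (\<Sum>j=m..<n. frac_monom t0 (real j - \<alpha>) t1)"
    define T where "T = frac_monom t0 (\<beta> - \<alpha>) t1"
    have S: "S \<ge> 0"
      unfolding S_def m_def using le_of_nat_ceiling[of \<alpha>] by (intro sum_nonneg frac_monom_nonneg) auto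
    have T: "T \<ge> 0" unfolding T_def using \<alpha>\<beta> by (intro frac_monom_nonneg) simp
    \<comment> \<open>The three summands account for the norm of the classical derivatives, the
      Taylor terms of the lower Caputo derivative, and its integral remainder.\<close>
    show "1 + S + T > 0" using S T by simp
    fix f :: "real \<Rightarrow> 'a" assume "f \<in> Calpha_space \<beta> t0 t1"
    then obtain c h where h: "continuous_on {t0..t1} h" and f: "\<forall>t\<in>{t0..t1}. f t =
      (\<Sum>j<n. frac_monom t0 (real j) t *\<^sub>R c j) + RL_integral \<beta> t0 h t" using rep by blast
    have B: "f \<in> Ck_space (n - 1) t0 t1" "\<And>j. j < n \<Longrightarrow> nderiv {t0..t1} j f t0 = c j"
      "\<And>t. t \<in> {t0..t1} \<Longrightarrow> Caputo_deriv \<beta> t0 t1 f t = h t"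
      using fractional_taylor_imp(1,2,4)[OF ab \<beta> n_def h, of f c] f by blast+
    define N where "N = Ck_norm (n - 1) t0 t1 f"
    define H where "H = sup_norm t0 t1 h"
    have sup0: "0 \<le> sup_norm t0 t1 (nderiv {t0..t1} j f)" if "j \<le> n - 1" for j
      using continuous_on_nderiv[OF B(1) that] ab by (intro sup_norm_nonneg) auto
    have N: "N \<ge> 0" unfolding N_def Ck_norm_def using sup0 by (intro sum_nonneg) auto
    have H: "H \<ge> 0" unfolding H_def using h ab by (intro sup_norm_nonneg) auto
    have norm\<beta>: "Calpha_norm \<beta> t0 t1 f = N + H"
      using \<beta> sup_norm_cong[of t0 t1 "Caputo_deriv \<beta> t0 t1 f" h] B(3)
      by (simp add: Calpha_norm_def N_def H_def n_def)
    \<comment> \<open>Each coefficient is a derivative at \<open>t0\<close>, and its supremum is one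
      of the summands of \<open>N\<close>.\<close>
    have c: "norm (c j) \<le> N" if "j < n" for j
    proof -
      have j: "j \<le> n - 1" using that by simp
      have "norm (c j) \<le> sup_norm t0 t1 (nderiv {t0..t1} j f)"
        using norm_le_sup_norm[OF continuous_on_nderiv[OF B(1) j], of t0] B(2)[OF that] ab by simp
      also have "\<dots> \<le> N"
        unfolding N_def Ck_norm_def using sup0 j by (intro member_le_sum) auto
      finally show ?thesis .
    qed
    have "sup_norm t0 t1 (?low c h) \<le> (\<Sum>j=m..<n. frac_monom t0 (real j - \<alpha>) t1 * norm (c j)) + T * H"
      unfolding m_def n_def T_def H_def by (rule sup_norm_lower_Caputo_le[OF ab \<alpha>\<beta> h])
    also have "\<dots> \<le> (\<Sum>j=m..<n. frac_monom t0 (real j - \<alpha>) t1 * N) + T * H"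
      using c le_of_nat_ceiling[of \<alpha>]
      by (intro add_right_mono sum_mono mult_left_mono frac_monom_nonneg) (auto simp: m_def)
    also have "\<dots> = S * N + T * H" by (simp add: S_def sum_distrib_right)
    finally have low: "sup_norm t0 t1 (?low c h) \<le> S * N + T * H" .
    have "Calpha_norm \<alpha> t0 t1 f \<le> N + sup_norm t0 t1 (?low c h)"
    proof (cases "\<alpha> = 0")
      case True
      \<comment> \<open>For \<open>\<alpha> = 0\<close> the representation of order
        \<open>\<alpha>\<close> says that \<open>f\<close> is \<open>?low c h\<close>.\<close>
      have "sup_norm t0 t1 f = sup_norm t0 t1 (?low c h)"
        using lower[OF h f] True by (intro sup_norm_cong) (simp add: m_def)
      then show ?thesis using True N by (simp add: Calpha_norm_def)
    next
      case False
      with assms(3) have \<alpha>: "\<alpha> > 0" by simp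
      have "Ck_norm (m - 1) t0 t1 f \<le> N"
        unfolding N_def Ck_norm_def using sup0 mn by (intro sum_mono2) auto
      moreover have "sup_norm t0 t1 (Caputo_deriv \<alpha> t0 t1 f) = sup_norm t0 t1 (?low c h)"
        by (intro sup_norm_cong fractional_taylor_imp(4)[OF ab \<alpha> m_def cont[OF h] lower[OF h f]])
      ultimately show ?thesis using \<alpha> by (simp add: Calpha_norm_def m_def)
    qed
    also have "\<dots> \<le> N + (S * N + T * H)" using low by simp
    \<comment> \<open>The product exceeds the left side by the nonnegative terms \<open>H\<close>,
      \<open>S * H\<close> and \<open>T * N\<close>.\<close>
    also have "\<dots> \<le> (1 + S + T) * (N + H)"
      using N H S T by (simp add: algebra_simps)
    finally show "Calpha_norm \<alpha> t0 t1 f \<le> (1 + S + T) * Calpha_norm \<beta> t0 t1 f"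
      by (simp add: norm\<beta>)
  qed
  ultimately show ?thesis by blast
qed

end
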